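(* Let $G=(\mathcal{V},\mathcal{E})$ be a finite simple graph with $|\mathcal{E}|\ge1$ which is $k$-degenerate. Then for every $d>k$ and every compact set $E\subset\mathbb{R}^d$ with $\dim(E)>\frac{d+k}{2}$, the $|\mathcal{E}|$-dimensional Lebesgue measure of $\Delta^{G}(E)$ is positive.
   Context: A graph $G$ is $k$-degenerate if $k$ is the least number such that every induced subgraph of $G$ contains a vertex with at most $k$ neighbors (in that subgraph). With $\mathcal{V}=\{v_1,\dots,v_{|\mathcal{V}|}\}$ and edges written $(v_i,v_j)$ with $i<j$, the $G$-distance set of $E$ is $\Delta^{G}(E)=\{(|x_i-x_j|)_{(v_i,v_j)\in\mathcal{E}} : x_1,\dots,x_{|\mathcal{V}|}\in E\}\subset\mathbb{R}^{|\mathcal{E}|}$. $\dim$ denotes Hausdorff dimension. *)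

theory Defs
  imports "HOL-Analysis.Analysis"
begin

text \<open>delta-approximating s-dimensional Hausdorff content: infimum of
  sum_i diam(U_i)^s over countable covers of A by bounded sets of diameter at most delta.
  (Boundedness is required because the library's diameter of an unbounded set is 0.)\<close>
definition hausdorff_content :: "real \<Rightarrow> real \<Rightarrow> 'a::metric_space set \<Rightarrow> ennreal" where
  "hausdorff_content s \<delta> A =
     (INF U \<in> {U :: nat \<Rightarrow> 'a set. A \<subseteq> (\<Union>i. U i) \<and> (\<forall>i. bounded (U i) \<and> diameter (U i) \<le> \<delta>)}.
        (\<Sum>i. ennreal (diameter (U i) powr s)))"

text \<open>s-dimensional Hausdorff (outer) measure (meaningful for s > 0).\<close>
definition hausdorff_measure :: "real \<Rightarrow> 'a::metric_space set \<Rightarrow> ennreal" where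
  "hausdorff_measure s A = (SUP \<delta> \<in> {0<..}. hausdorff_content s \<delta> A)"

definition hausdorff_dim :: "'a::metric_space set \<Rightarrow> real" where
  "hausdorff_dim A = Inf {s::real. 0 < s \<and> hausdorff_measure s A = 0}"

text \<open>A finite simple graph is given by a finite linearly ordered vertex type 'v
  (the order is the enumeration v_1, ..., v_n) and a finite edge type 'e together with
  an injective map ends assigning to each edge its endpoints (v_i, v_j) with i < j.\<close>
definition simple_graph :: "('e \<Rightarrow> 'v::linorder \<times> 'v) \<Rightarrow> bool" where
  "simple_graph ends \<longleftrightarrow> (\<forall>e. fst (ends e) < snd (ends e)) \<and> inj ends"

definition adjacent :: "('e \<Rightarrow> 'v \<times> 'v) \<Rightarrow> 'v \<Rightarrow> 'v \<Rightarrow> bool" where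
  "adjacent ends u v \<longleftrightarrow> (\<exists>e. ends e = (u, v) \<or> ends e = (v, u))"

definition degeneracy_bound :: "('e \<Rightarrow> 'v \<times> 'v) \<Rightarrow> nat \<Rightarrow> bool" where
  "degeneracy_bound ends k \<longleftrightarrow>
     (\<forall>S. S \<noteq> {} \<longrightarrow> (\<exists>v\<in>S. card {u \<in> S. adjacent ends u v} \<le> k))"

definition k_degenerate :: "('e \<Rightarrow> 'v \<times> 'v) \<Rightarrow> nat \<Rightarrow> bool" where
  "k_degenerate ends k \<longleftrightarrow> degeneracy_bound ends k \<and> (\<forall>j<k. \<not> degeneracy_bound ends j)"

definition G_distance_set :: "('e::finite \<Rightarrow> 'v \<times> 'v) \<Rightarrow> (real^'d) set \<Rightarrow> (real^'e) set" where
  "G_distance_set ends E =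
     {(\<chi> e. dist (x (fst (ends e))) (x (snd (ends e)))) | x. \<forall>v. x v \<in> E}"

end

theory Submission
  imports Defs "HOL-Probability.Probability"
begin

text \<open>Let \<open>M\<close> be a Frostman measure on \<open>E\<close> of exponent \<open>s > (d + k) / 2\<close>. Choose the vertices independently
  with law \<open>M\<close>, in an order in which every vertex has at most \<open>k\<close> earlier neighbours. Given the earlier
  points, the vector of squared distances from the new point \<open>z\<close> to its \<open>m \<le> k\<close> earlier neighbours has
  characteristic function \<open>\<tau> \<mapsto> \<integral> exp (i \<Sum> \<tau>\<^sub>e |z - x\<^sub>e|\<^sup>2) dM(z)\<close>. Averaging its square over the
  neighbour belonging to the largest \<open>|\<tau>\<^sub>e|\<close> gives decay \<open>O(|\<tau>|\<^sup>d\<^sup>-\<^sup>2\<^sup>s)\<close>, which is integrable over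
  \<open>\<real>\<^sup>m\<close> because \<open>2s - d > k\<close>. Hence for almost all earlier points the characteristic function is square
  integrable and the conditional law is absolutely continuous. By induction no null set has positive
  probability for the full vector of squared distances, so the distance set is not null.\<close>

section \<open>Gaussian Fourier integrals\<close>

text \<open>The rate \<open>d - 2s\<close> comes from three powers of the frequency
  \<open>\<tau>\<close>. The squared characteristic function must be averaged over \<open>M\<close>,
  which may be singular, so Plancherel does not apply directly. Each value is first replaced by an
  average over a Gaussian window of width about \<open>1 / |\<tau>|\<close>. The Frostman condition
  then gains \<open>|\<tau>|^(-s)\<close> twice: once in the pair energy that Plancherel produces,
  once as the mass that \<open>M\<close> gives to such a window. Normalising the window costs
  \<open>|\<tau>|^d\<close>. The other earlier points stay frozen and only contribute an arbitrary
  phase. The decay in the largest coordinate is shared equally among the \<open>m\<close>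
  coordinates, and \<open>2s - d > k\<close> leaves each of them an exponent above 1. Two obstacles
  shape the induction. A partial distance vector has too few coordinates to be compared with
  Lebesgue measure on the full space, so the missing ones are filled with an independent Gaussian.
  The null set met when a vertex is added depends on the earlier points, so for almost all earlier
  points the conditional law must ignore all null sets at once.\<close>

lemma borel_measurable_cis [measurable]: "cis \<in> borel_measurable borel"
  by (intro borel_measurable_continuous_onI continuous_intros)

text \<open>This is the characteristic function of the standard normal distribution with the
  normalisation of its density removed.\<close>

lemma gaussian_fourier_real_std:
  "has_bochner_integral lborel (\<lambda>x. of_real (exp (- x\<^sup>2 / 2)) * cis (\<xi> * x))
     (of_real (sqrt (2 * pi) * exp (- \<xi>\<^sup>2 / 2)))"
proof -
  have "complex_of_real (exp (- \<xi>\<^sup>2 / 2)) = (CLINT x|std_normal_distribution. cis (\<xi> * x))"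
    using fun_cong[OF char_std_normal_distribution, of \<xi>] by (simp add: char_def cis_conv_exp)
  also have "\<dots> = (LINT x|lborel. std_normal_density x *\<^sub>R cis (\<xi> * x))"
    by (subst integral_density) (auto simp: normal_density_nonneg)
  also have "\<dots> = (LINT x|lborel. of_real (1 / sqrt (2 * pi)) * (of_real (exp (- x\<^sup>2 / 2)) * cis (\<xi> * x)))"
    by (intro Bochner_Integration.integral_cong) (auto simp: std_normal_density_def scaleR_conv_of_real mult.assoc)
  also have "\<dots> = of_real (1 / sqrt (2 * pi)) * (LINT x|lborel. (of_real (exp (- x\<^sup>2 / 2)) * cis (\<xi> * x)))"
    by (rule integral_mult_right_zero)
  finally have *: "(LINT x|lborel. (of_real (exp (- x\<^sup>2 / 2)) * cis (\<xi> * x))) = of_real (sqrt (2 * pi) * exp (- \<xi>\<^sup>2 / 2))"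
    by (auto simp: field_simps)
  have "integrable lborel (\<lambda>x. sqrt (2 * pi) * std_normal_density x)"
    by (intro integrable_mult_right integrable_normal_density) simp
  then have "integrable lborel (\<lambda>x::real. exp (- x\<^sup>2 / 2))"
    by (simp add: std_normal_density_def)
  then have "integrable lborel (\<lambda>x. of_real (exp (- x\<^sup>2 / 2)) * cis (\<xi> * x))"
    by (rule Bochner_Integration.integrable_bound) (auto simp: norm_mult)
  with * show ?thesis by (simp add: has_bochner_integral_iff)
qed

lemma gaussian_fourier_real:
  assumes "a > 0"
  shows "has_bochner_integral lborel (\<lambda>x. of_real (exp (- a * x\<^sup>2)) * cis (\<xi> * x))
     (of_real (sqrt (pi / a) * exp (- \<xi>\<^sup>2 / (4 * a))))"
proof -
  \<comment> \<open>The substitution by this factor turns \<open>x^2 / 2\<close> into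
    \<open>a * x^2\<close>.\<close>
  define c where "c = sqrt (2 * a)"
  have c: "c > 0" "c\<^sup>2 = 2 * a" using assms by (auto simp: c_def)
  let ?f = "\<lambda>x. complex_of_real (exp (- x\<^sup>2 / 2)) * cis (\<xi> / c * x)"
  note st = gaussian_fourier_real_std[of "\<xi> / c", unfolded has_bochner_integral_iff]
  have eq: "?f (0 + c * x) = of_real (exp (- a * x\<^sup>2)) * cis (\<xi> * x)" for x
    using c by (simp add: power_mult_distrib)
  have int: "integrable lborel (\<lambda>x. ?f (0 + c * x))"
    using lborel_integrable_real_affine[of ?f c 0] st c by auto
  have "(LINT x|lborel. ?f x) = \<bar>c\<bar> *\<^sub>R (LINT x|lborel. ?f (0 + c * x))"
    using c by (intro lborel_integral_real_affine) auto
  then have "(LINT x|lborel. ?f (0 + c * x)) = of_real (sqrt (2 * pi) * exp (- (\<xi> / c)\<^sup>2 / 2)) / of_real c"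
    using c st by (simp add: field_simps scaleR_conv_of_real)
  also have "(\<xi> / c)\<^sup>2 / 2 = \<xi>\<^sup>2 / (4 * a)" using c by (simp add: power_divide)
  then have "complex_of_real (sqrt (2 * pi) * exp (- (\<xi> / c)\<^sup>2 / 2)) / of_real c
     = of_real (sqrt (pi / a) * exp (- \<xi>\<^sup>2 / (4 * a)))"
    using assms by (simp add: c_def real_sqrt_divide real_sqrt_mult field_simps)
  finally show ?thesis using int unfolding eq has_bochner_integral_iff by simp
qed

lemma prod_cis: "finite I \<Longrightarrow> (\<Prod>i\<in>I. cis (f i)) = cis (\<Sum>i\<in>I. f i)"
  by (induction I rule: finite_induct) (auto simp: cis_mult)

text \<open>Both factors of the integrand split over the coordinates, so Fubini reduces the integral
  to a product of one-dimensional ones.\<close>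

lemma gaussian_fourier:
  fixes \<xi> :: "'a::euclidean_space"
  assumes a: "a > 0"
  shows "has_bochner_integral lborel (\<lambda>x. of_real (exp (- a * (norm x)\<^sup>2)) * cis (\<xi> \<bullet> x))
     (of_real (sqrt (pi / a) ^ DIM('a) * exp (- (norm \<xi>)\<^sup>2 / (4 * a))))"
proof -
  interpret P: product_sigma_finite "\<lambda>b::'a. lborel :: real measure" by standard
  let ?T = "\<lambda>f. \<Sum>b\<in>(Basis :: 'a set). f b *\<^sub>R b"
  let ?h = "\<lambda>x::'a. complex_of_real (exp (- a * (norm x)\<^sup>2)) * cis (\<xi> \<bullet> x)"
  let ?k = "\<lambda>b x. complex_of_real (exp (- a * x\<^sup>2)) * cis ((\<xi> \<bullet> b) * x)"
  have n2: "(norm (?T f))\<^sup>2 = (\<Sum>b\<in>Basis. (f b)\<^sup>2)" for f :: "'a \<Rightarrow> real"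
    unfolding power2_norm_eq_inner by (subst euclidean_inner) (simp add: power2_eq_square)
  have ip: "\<xi> \<bullet> ?T f = (\<Sum>b\<in>Basis. (\<xi> \<bullet> b) * f b)" for f :: "'a \<Rightarrow> real"
    by (simp add: inner_sum_right mult.commute)
  have eq: "?h (?T f) = (\<Prod>b\<in>Basis. ?k b (f b))" for f
    unfolding n2 ip prod.distrib prod_cis[OF finite_Basis]
    by (simp add: sum_distrib_left exp_sum sum_negf[symmetric])
  note g1 = gaussian_fourier_real[OF a, unfolded has_bochner_integral_iff]
  have T: "?T \<in> measurable (Pi\<^sub>M Basis (\<lambda>b. lborel)) borel" by measurable
  have "integrable (Pi\<^sub>M Basis (\<lambda>b. lborel)) (\<lambda>f. \<Prod>b\<in>Basis. ?k b (f b))"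
    using g1 by (intro P.product_integrable_prod) auto
  then have 1: "integrable lborel ?h"
    unfolding eq[symmetric] by (subst lborel_eq, subst integrable_distr_eq[OF T]) simp_all
  have "(LINT x|lborel. ?h x) = (LINT f|Pi\<^sub>M Basis (\<lambda>b. lborel). ?h (?T f))"
    by (subst lborel_eq, subst integral_distr[OF T]) simp_all
  also have "\<dots> = (\<Prod>b\<in>Basis. LINT x|lborel. ?k b x)"
    unfolding eq using g1 by (intro P.product_integral_prod) auto
  also have "\<dots> = (\<Prod>b\<in>Basis. of_real (sqrt (pi / a) * exp (- (\<xi> \<bullet> b)\<^sup>2 / (4 * a))))"
    using g1 by (intro prod.cong) auto
  also have "\<dots> = of_real (sqrt (pi / a) ^ DIM('a) * exp (- (norm \<xi>)\<^sup>2 / (4 * a)))"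
  proof -
    have "(norm \<xi>)\<^sup>2 = (\<Sum>b\<in>Basis. (\<xi> \<bullet> b)\<^sup>2)"
      unfolding power2_norm_eq_inner by (subst euclidean_inner[of \<xi> \<xi>]) (simp add: power2_eq_square)
    then show ?thesis
      by (simp add: prod.distrib sum_divide_distrib sum_negf flip: of_real_prod exp_sum)
  qed
  finally show ?thesis using 1 by (simp add: has_bochner_integral_iff)
qed

lemma gaussian_fourier_shift:
  fixes \<xi> y :: "'a::euclidean_space"
  assumes a: "a > 0"
  shows "has_bochner_integral lborel (\<lambda>x. of_real (exp (- a * (norm (x - y))\<^sup>2)) * cis (\<xi> \<bullet> x))
     (cis (\<xi> \<bullet> y) * of_real (sqrt (pi / a) ^ DIM('a) * exp (- (norm \<xi>)\<^sup>2 / (4 * a))))"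
proof -
  let ?h = "\<lambda>x. complex_of_real (exp (- a * (norm (x - y))\<^sup>2)) * cis (\<xi> \<bullet> x)"
  have eq: "?h (y + x) = cis (\<xi> \<bullet> y) * (of_real (exp (- a * (norm x)\<^sup>2)) * cis (\<xi> \<bullet> x))" for x
    by (simp add: inner_add_right cis_mult[symmetric])
  have "has_bochner_integral lborel (\<lambda>x. ?h (y + x))
     (cis (\<xi> \<bullet> y) * of_real (sqrt (pi / a) ^ DIM('a) * exp (- (norm \<xi>)\<^sup>2 / (4 * a))))"
    unfolding eq by (intro has_bochner_integral_mult_right gaussian_fourier a)
  then have "has_bochner_integral (distr lborel borel ((+) y)) ?h
     (cis (\<xi> \<bullet> y) * of_real (sqrt (pi / a) ^ DIM('a) * exp (- (norm \<xi>)\<^sup>2 / (4 * a))))"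
    by (subst has_bochner_integral_distr) auto
  then show ?thesis by (simp add: lborel_distr_plus)
qed

lemma nn_integral_gaussian:
  fixes y :: "'a::euclidean_space"
  assumes a: "a > 0"
  shows "(\<integral>\<^sup>+x. ennreal (exp (- a * (norm (x - y))\<^sup>2)) \<partial>lborel) = ennreal (sqrt (pi / a) ^ DIM('a))"
proof -
  have "has_bochner_integral lborel (\<lambda>x::'a. complex_of_real (exp (- a * (norm (x - y))\<^sup>2)))
     (complex_of_real (sqrt (pi / a) ^ DIM('a)))"
    using gaussian_fourier_shift[OF a, of y 0] by simp
  then have "has_bochner_integral lborel (\<lambda>x::'a. exp (- a * (norm (x - y))\<^sup>2)) (sqrt (pi / a) ^ DIM('a))"
    by (simp only: has_bochner_integral_iff complex_of_real_integrable_eq integral_complex_of_real of_real_eq_iff)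
  then show ?thesis
    by (simp add: has_bochner_integral_iff nn_integral_eq_integral)
qed

text \<open>A Plancherel identity that survives singular measures. The square of
  \<open>\<Phi>\<close> is a double integral over \<open>M\<close> and itself, and integrating over
  \<open>\<eta>\<close> first turns each pair of points into a Gaussian of the distance of their
  images. The transform of a finite measure need not be square integrable; the Gaussian weight makes
  Fubini available.\<close>

lemma
  fixes \<xi> :: "'b \<Rightarrow> 'a::euclidean_space" and h :: "'b \<Rightarrow> complex"
  assumes M: "finite_measure M" and a: "a > 0"
    and [measurable]: "\<xi> \<in> borel_measurable M" "h \<in> borel_measurable M"
    and h: "\<And>z. norm (h z) \<le> c"
  defines "\<Phi> \<equiv> \<lambda>\<eta>. LINT z|M. h z * cis (\<xi> z \<bullet> \<eta>)"
  shows integrable_gaussian_square: "integrable lborel (\<lambda>\<eta>. exp (- a * (norm \<eta>)\<^sup>2) * (norm (\<Phi> \<eta>))\<^sup>2)" (is ?A)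
    and integral_gaussian_square: "complex_of_real (LINT \<eta>|lborel. exp (- a * (norm \<eta>)\<^sup>2) * (norm (\<Phi> \<eta>))\<^sup>2) =
      (LINT p|(M \<Otimes>\<^sub>M M). h (fst p) * cnj (h (snd p)) *
         of_real (sqrt (pi / a) ^ DIM('a) * exp (- (norm (\<xi> (fst p) - \<xi> (snd p)))\<^sup>2 / (4 * a))))" (is ?B)
proof -
  interpret M: finite_measure M by fact
  interpret MM: pair_sigma_finite M M by standard
  interpret N: finite_measure "M \<Otimes>\<^sub>M M" by (intro finite_measure_pair_measure M)
  interpret P: pair_sigma_finite lborel "M \<Otimes>\<^sub>M M" by standard
  have c: "c \<ge> 0" using h[of undefined] norm_ge_zero by (rule order_trans[rotated])
  define F where "F = (\<lambda>(\<eta>, p). complex_of_real (exp (- a * (norm \<eta>)\<^sup>2)) *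
      (h (fst p) * cnj (h (snd p)) * cis ((\<xi> (fst p) - \<xi> (snd p)) \<bullet> \<eta>)))"
  have [measurable]: "cnj \<in> borel_measurable borel"
    by (intro borel_measurable_continuous_onI continuous_intros)
  have Fm[measurable]: "F \<in> borel_measurable (lborel \<Otimes>\<^sub>M (M \<Otimes>\<^sub>M M))"
    unfolding F_def by measurable
  have hh: "norm (h (fst p) * cnj (h (snd p))) \<le> c * c" for p
    using h[of "fst p"] h[of "snd p"] c by (simp add: norm_mult mult_mono)
  have ihh: "integrable (M \<Otimes>\<^sub>M M) (\<lambda>p. h (fst p) * cnj (h (snd p)) * cis ((\<xi> (fst p) - \<xi> (snd p)) \<bullet> \<eta>))" for \<eta>
    using hh by (intro N.integrable_const_bound[of _ "c * c"]) (auto simp: norm_mult)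
  have inth: "integrable M (\<lambda>z. h z * cis (\<xi> z \<bullet> \<eta>))" for \<eta>
    using h by (intro M.integrable_const_bound[of _ c]) (auto simp: norm_mult)
  have sq: "(LINT p|(M \<Otimes>\<^sub>M M). F (\<eta>, p)) = of_real (exp (- a * (norm \<eta>)\<^sup>2) * (norm (\<Phi> \<eta>))\<^sup>2)" for \<eta>
  proof -
    have "(LINT p|(M \<Otimes>\<^sub>M M). h (fst p) * cnj (h (snd p)) * cis ((\<xi> (fst p) - \<xi> (snd p)) \<bullet> \<eta>))
       = (LINT z|M. LINT z'|M. h z * cnj (h z') * cis ((\<xi> z - \<xi> z') \<bullet> \<eta>))"
      using MM.integral_fst'[OF ihh[of \<eta>]] by simp
    also have "\<dots> = (LINT z|M. LINT z'|M. (h z * cis (\<xi> z \<bullet> \<eta>)) * cnj (h z' * cis (\<xi> z' \<bullet> \<eta>)))"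
      by (simp add: inner_diff_left cis_cnj cis_mult mult_ac flip: cis_mult[of _ "- _"])
    also have "\<dots> = \<Phi> \<eta> * cnj (\<Phi> \<eta>)"
      by (simp only: integral_mult_right_zero integral_mult_left_zero Bochner_Integration.integral_cnj \<Phi>_def)
    finally have "(LINT p|(M \<Otimes>\<^sub>M M). h (fst p) * cnj (h (snd p)) * cis ((\<xi> (fst p) - \<xi> (snd p)) \<bullet> \<eta>))
       = of_real ((norm (\<Phi> \<eta>))\<^sup>2)" by (simp only: complex_norm_square)
    then show ?thesis unfolding F_def by simp
  qed
  have g: "integrable lborel (\<lambda>\<eta>::'a. exp (- a * (norm \<eta>)\<^sup>2))"
    using gaussian_fourier[OF a, of "0::'a"] by (simp add: has_bochner_integral_iff complex_of_real_integrable_eq)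
  have "integrable (lborel \<Otimes>\<^sub>M (M \<Otimes>\<^sub>M M)) F"
  proof (rule P.Fubini_integrable[OF Fm])
    have "(LINT p|(M \<Otimes>\<^sub>M M). norm (F (\<eta>, p))) = exp (- a * (norm \<eta>)\<^sup>2) * (LINT p|(M \<Otimes>\<^sub>M M). norm (h (fst p) * cnj (h (snd p))))" for \<eta>
      unfolding F_def by (simp add: norm_mult)
    then show "integrable lborel (\<lambda>\<eta>. LINT p|(M \<Otimes>\<^sub>M M). norm (F (\<eta>, p)))"
      using g by (simp only: integrable_mult_left)
  qed (use ihh in \<open>auto simp: F_def\<close>)
  note iF = this
  have "integrable lborel (\<lambda>\<eta>. LINT p|(M \<Otimes>\<^sub>M M). F (\<eta>, p))"
    using P.integrable_fst'[OF iF] .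
  then show ?A unfolding sq complex_of_real_integrable_eq .
  have "complex_of_real (LINT \<eta>|lborel. exp (- a * (norm \<eta>)\<^sup>2) * (norm (\<Phi> \<eta>))\<^sup>2) = (LINT \<eta>|lborel. LINT p|(M \<Otimes>\<^sub>M M). F (\<eta>, p))"
    unfolding sq by (rule integral_complex_of_real[symmetric])
  also have "\<dots> = (LINT p|(M \<Otimes>\<^sub>M M). LINT \<eta>|lborel. F (\<eta>, p))"
    using P.Fubini_integral[of "\<lambda>\<eta> p. F (\<eta>, p)"] iF by simp
  also have "\<dots> = (LINT p|(M \<Otimes>\<^sub>M M). h (fst p) * cnj (h (snd p)) *
         of_real (sqrt (pi / a) ^ DIM('a) * exp (- (norm (\<xi> (fst p) - \<xi> (snd p)))\<^sup>2 / (4 * a))))"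
  proof (intro Bochner_Integration.integral_cong refl)
    fix p
    show "(LINT \<eta>|lborel. F (\<eta>, p)) = h (fst p) * cnj (h (snd p)) *
         of_real (sqrt (pi / a) ^ DIM('a) * exp (- (norm (\<xi> (fst p) - \<xi> (snd p)))\<^sup>2 / (4 * a)))"
      using gaussian_fourier[OF a, of "\<xi> (fst p) - \<xi> (snd p)", THEN has_bochner_integral_mult_right, of "h (fst p) * cnj (h (snd p))"]
      by (simp add: F_def has_bochner_integral_iff mult_ac)
  qed
  finally show ?B .
qed

text \<open>The pair energy on the right contains no phase: a bounded modulation \<open>h\<close>
  costs only the factor \<open>c^2\<close>, whatever its oscillation. The inequality serves the
  oscillatory estimate, the equality the criterion for null sets.\<close>

lemma
  fixes \<xi> :: "'b \<Rightarrow> 'a::euclidean_space" and h :: "'b \<Rightarrow> complex"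
  assumes M: "finite_measure M" and a: "a > 0"
    and [measurable]: "\<xi> \<in> borel_measurable M"
  shows nn_integral_gaussian_square_le: "h \<in> borel_measurable M \<Longrightarrow> (\<And>z. norm (h z) \<le> c) \<Longrightarrow>
     (\<integral>\<^sup>+\<eta>. ennreal (exp (- a * (norm \<eta>)\<^sup>2) * (norm (LINT z|M. h z * cis (\<xi> z \<bullet> \<eta>)))\<^sup>2) \<partial>lborel)
      \<le> ennreal (c\<^sup>2 * sqrt (pi / a) ^ DIM('a)) *
        (\<integral>\<^sup>+z. \<integral>\<^sup>+z'. ennreal (exp (- (norm (\<xi> z - \<xi> z'))\<^sup>2 / (4 * a))) \<partial>M \<partial>M)"
    and nn_integral_gaussian_square_eq:
     "(\<integral>\<^sup>+\<eta>. ennreal (exp (- a * (norm \<eta>)\<^sup>2) * (norm (LINT z|M. cis (\<xi> z \<bullet> \<eta>)))\<^sup>2) \<partial>lborel)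
      = ennreal (sqrt (pi / a) ^ DIM('a)) *
        (\<integral>\<^sup>+z. \<integral>\<^sup>+z'. ennreal (exp (- (norm (\<xi> z - \<xi> z'))\<^sup>2 / (4 * a))) \<partial>M \<partial>M)"
proof -
  let ?A = "\<integral>\<^sup>+\<eta>. ennreal (exp (- a * (norm \<eta>)\<^sup>2) * (norm (LINT z|M. h z * cis (\<xi> z \<bullet> \<eta>)))\<^sup>2) \<partial>lborel"
  let ?B = "\<integral>\<^sup>+z. \<integral>\<^sup>+z'. ennreal (exp (- (norm (\<xi> z - \<xi> z'))\<^sup>2 / (4 * a))) \<partial>M \<partial>M"
  let ?C = "\<integral>\<^sup>+\<eta>. ennreal (exp (- a * (norm \<eta>)\<^sup>2) * (norm (LINT z|M. cis (\<xi> z \<bullet> \<eta>)))\<^sup>2) \<partial>lborel"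
  interpret M: finite_measure M by fact
  interpret N: finite_measure "M \<Otimes>\<^sub>M M" by (intro finite_measure_pair_measure M)
  let ?e = "\<lambda>p. exp (- (norm (\<xi> (fst p) - \<xi> (snd p)))\<^sup>2 / (4 * a))"
  have ie: "integrable (M \<Otimes>\<^sub>M M) ?e"
    using a by (intro N.integrable_const_bound[of _ 1]) auto
  have B: "?B = ennreal (LINT p|(M \<Otimes>\<^sub>M M). ?e p)"
    using M.nn_integral_fst[of "\<lambda>p. ennreal (?e p)" M] nn_integral_eq_integral[OF ie] by simp
  have e0: "0 \<le> (LINT p|(M \<Otimes>\<^sub>M M). ?e p)" by simp
  have Z: "0 \<le> sqrt (pi / a) ^ DIM('a)" using a by simp
  {
    assume h[measurable]: "h \<in> borel_measurable M" and hc: "\<And>z. norm (h z) \<le> c"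
    let ?w = "\<lambda>p. h (fst p) * cnj (h (snd p)) * complex_of_real (sqrt (pi / a) ^ DIM('a) * ?e p)"
    have c: "c \<ge> 0" using hc[of undefined] norm_ge_zero by (rule order_trans[rotated])
    have A: "?A = ennreal (LINT \<eta>|lborel. exp (- a * (norm \<eta>)\<^sup>2) * (norm (LINT z|M. h z * cis (\<xi> z \<bullet> \<eta>)))\<^sup>2)"
      by (intro nn_integral_eq_integral integrable_gaussian_square[where c=c] M a hc) auto
    have "(LINT \<eta>|lborel. exp (- a * (norm \<eta>)\<^sup>2) * (norm (LINT z|M. h z * cis (\<xi> z \<bullet> \<eta>)))\<^sup>2)
       \<le> norm (LINT p|(M \<Otimes>\<^sub>M M). ?w p)"
      by (subst integral_gaussian_square[OF M a _ h hc, symmetric]) auto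
    also have "\<dots> \<le> (LINT p|(M \<Otimes>\<^sub>M M). c\<^sup>2 * sqrt (pi / a) ^ DIM('a) * ?e p)"
    proof (rule order_trans[OF integral_norm_bound integral_mono])
      show le: "norm (?w p) \<le> c\<^sup>2 * sqrt (pi / a) ^ DIM('a) * ?e p" for p
      proof -
        have "norm (?w p) = (norm (h (fst p)) * norm (h (snd p))) * (sqrt (pi / a) ^ DIM('a) * ?e p)"
          using Z unfolding norm_mult norm_of_real complex_mod_cnj abs_mult by (simp only: abs_exp_cancel abs_of_nonneg)
        also have "\<dots> \<le> (c * c) * (sqrt (pi / a) ^ DIM('a) * ?e p)"
          using hc c Z by (intro mult_right_mono mult_mono) auto
        finally show ?thesis by (simp add: power2_eq_square mult.assoc)
      qed
      show I: "integrable (M \<Otimes>\<^sub>M M) (\<lambda>p. c\<^sup>2 * sqrt (pi / a) ^ DIM('a) * ?e p)"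
        by (intro integrable_mult_right ie)
      have [measurable]: "cnj \<in> borel_measurable borel"
        by (intro borel_measurable_continuous_onI continuous_intros)
      show "integrable (M \<Otimes>\<^sub>M M) (\<lambda>p. norm (?w p))"
      proof (rule integrable_norm, rule Bochner_Integration.integrable_bound[OF I])
        show "?w \<in> borel_measurable (M \<Otimes>\<^sub>M M)" by measurable
        show "AE p in M \<Otimes>\<^sub>M M. norm (?w p) \<le> norm (c\<^sup>2 * sqrt (pi / a) ^ DIM('a) * ?e p)"
          using order_trans[OF le abs_ge_self] by (intro AE_I2) (simp only: real_norm_def)
      qed
    qed
    also have "\<dots> = c\<^sup>2 * sqrt (pi / a) ^ DIM('a) * (LINT p|(M \<Otimes>\<^sub>M M). ?e p)"
      by (rule integral_mult_right_zero)
    finally have "?A \<le> ennreal (c\<^sup>2 * sqrt (pi / a) ^ DIM('a) * (LINT p|(M \<Otimes>\<^sub>M M). ?e p))"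
      unfolding A by (rule ennreal_leI)
    also have "\<dots> = ennreal (c\<^sup>2 * sqrt (pi / a) ^ DIM('a)) * ?B"
      unfolding B using Z by (intro ennreal_mult e0) simp
    finally show "?A \<le> ennreal (c\<^sup>2 * sqrt (pi / a) ^ DIM('a)) * ?B" .
  }
  have "?C = ennreal (LINT \<eta>|lborel. exp (- a * (norm \<eta>)\<^sup>2) * (norm (LINT z|M. cis (\<xi> z \<bullet> \<eta>)))\<^sup>2)"
    using integrable_gaussian_square[OF M a, of \<xi> "\<lambda>_. 1" 1] by (intro nn_integral_eq_integral) auto
  also have "(LINT \<eta>|lborel. exp (- a * (norm \<eta>)\<^sup>2) * (norm (LINT z|M. cis (\<xi> z \<bullet> \<eta>)))\<^sup>2)
     = sqrt (pi / a) ^ DIM('a) * (LINT p|(M \<Otimes>\<^sub>M M). ?e p)"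
  proof -
    have "complex_of_real (LINT \<eta>|lborel. exp (- a * (norm \<eta>)\<^sup>2) * (norm (LINT z|M. cis (\<xi> z \<bullet> \<eta>)))\<^sup>2)
       = (LINT p|(M \<Otimes>\<^sub>M M). of_real (sqrt (pi / a) ^ DIM('a) * ?e p))"
      using integral_gaussian_square[OF M a, of \<xi> "\<lambda>_. 1" 1]
      by (simp only: mult_1_left complex_cnj_one norm_one order_refl borel_measurable_const assms simp_thms)
    also have "\<dots> = of_real (LINT p|(M \<Otimes>\<^sub>M M). sqrt (pi / a) ^ DIM('a) * ?e p)"
      by (rule integral_complex_of_real)
    finally show ?thesis by (simp only: of_real_eq_iff integral_mult_right_zero)
  qed
  finally show "?C = ennreal (sqrt (pi / a) ^ DIM('a)) * ?B"
    unfolding B using Z by (simp only: ennreal_mult e0)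
qed

section \<open>Null sets of laws with a square-integrable characteristic function\<close>

lemma parallelogram_midpoint:
  fixes x x' y :: "'a::real_inner"
  shows "(norm (y - x))\<^sup>2 + (norm (y - x'))\<^sup>2 = 2 * (norm (y - (1/2) *\<^sub>R (x + x')))\<^sup>2 + (norm (x - x'))\<^sup>2 / 2"
  unfolding power2_norm_eq_inner
  by (simp add: inner_diff_left inner_diff_right inner_add_left inner_add_right inner_commute algebra_simps)
     (simp add: field_simps)

text \<open>Normalised to mass 1 for \<open>a > 0\<close>; the width is of order
  \<open>1 / sqrt a\<close>, so large \<open>a\<close> approximates a point mass.\<close>

definition gauss_density :: "real \<Rightarrow> 'a::euclidean_space \<Rightarrow> real" where
  "gauss_density a v = sqrt (a / pi) ^ DIM('a) * exp (- a * (norm v)\<^sup>2)"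

lemma borel_measurable_gauss_density [measurable]: "gauss_density a \<in> borel_measurable borel"
  unfolding gauss_density_def[abs_def] by measurable

lemma gauss_density_nonneg: "a > 0 \<Longrightarrow> 0 \<le> gauss_density a v"
  by (simp add: gauss_density_def)

lemma nn_integral_gauss_density:
  assumes "a > 0" shows "(\<integral>\<^sup>+v. ennreal (gauss_density a (v - y)) \<partial>lborel) = 1"
proof -
  have "(\<integral>\<^sup>+v. ennreal (gauss_density a (v - y)) \<partial>lborel) = ennreal (sqrt (a / pi) ^ DIM('a)) * ennreal (sqrt (pi / a) ^ DIM('a))"
    unfolding gauss_density_def using assms
    by (simp add: ennreal_mult nn_integral_cmult nn_integral_gaussian[OF assms, simplified])
  also have "\<dots> = ennreal ((sqrt (a / pi) * sqrt (pi / a)) ^ DIM('a))"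
    using assms by (simp add: power_mult_distrib flip: ennreal_mult)
  also have "sqrt (a / pi) * sqrt (pi / a) = 1"
    using assms by (simp flip: real_sqrt_mult)
  finally show ?thesis by simp
qed

text \<open>Completing the square at the midpoint of \<open>x\<close> and \<open>x'\<close> leaves a
  Gaussian in \<open>x - x'\<close>. The exponent is written as \<open>4 * (1 / (2 * a))\<close> to
  match the pair energy in \<open>nn_integral_gaussian_square_eq\<close> with parameter
  \<open>1 / (2 * a)\<close>.\<close>

lemma gauss_density_correlation:
  fixes x x' :: "'a::euclidean_space"
  assumes a: "a > 0"
  shows "(\<integral>\<^sup>+y. ennreal (gauss_density a (y - x)) * ennreal (gauss_density a (y - x')) \<partial>lborel)
    = ennreal (sqrt (a / (2 * pi)) ^ DIM('a)) * ennreal (exp (- (norm (x - x'))\<^sup>2 / (4 * (1 / (2 * a)))))"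
proof -
  let ?n = "DIM('a)"
  have "ennreal (gauss_density a (y - x)) * ennreal (gauss_density a (y - x'))
     = ennreal (sqrt (a / pi) ^ ?n * sqrt (a / pi) ^ ?n * exp (- (norm (x - x'))\<^sup>2 / (4 * (1 / (2 * a))))) *
       ennreal (exp (- (2 * a) * (norm (y - (1/2) *\<^sub>R (x + x')))\<^sup>2))" for y
  proof -
    have "exp (- a * (norm (y - x))\<^sup>2) * exp (- a * (norm (y - x'))\<^sup>2)
      = exp (- a * ((norm (y - x))\<^sup>2 + (norm (y - x'))\<^sup>2))" by (simp add: exp_add[symmetric] algebra_simps)
    also have "\<dots> = exp (- (norm (x - x'))\<^sup>2 / (4 * (1 / (2 * a)))) * exp (- (2 * a) * (norm (y - (1/2) *\<^sub>R (x + x')))\<^sup>2)"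
      unfolding parallelogram_midpoint by (simp add: exp_add[symmetric] algebra_simps)
    finally show ?thesis using a unfolding gauss_density_def
      by (simp add: mult_ac flip: ennreal_mult)
  qed
  then have "(\<integral>\<^sup>+y. ennreal (gauss_density a (y - x)) * ennreal (gauss_density a (y - x')) \<partial>lborel)
    = ennreal (sqrt (a / pi) ^ ?n * sqrt (a / pi) ^ ?n * exp (- (norm (x - x'))\<^sup>2 / (4 * (1 / (2 * a))))) * ennreal (sqrt (pi / (2 * a)) ^ ?n)"
    using a by (subst nn_integral_gaussian[of "2 * a", symmetric]) (simp_all add: nn_integral_cmult)
  also have "\<dots> = ennreal ((sqrt (a / pi) * sqrt (a / pi) * sqrt (pi / (2 * a))) ^ ?n * exp (- (norm (x - x'))\<^sup>2 / (4 * (1 / (2 * a)))))"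
    unfolding power_mult_distrib using a by (simp add: mult_ac flip: ennreal_mult)
  also have "sqrt (a / pi) * sqrt (a / pi) * sqrt (pi / (2 * a)) = sqrt (a / (2 * pi))"
    using a by (simp only: real_sqrt_mult[symmetric]) (simp add: field_simps)
  finally show ?thesis using a by (simp add: ennreal_mult)
qed

text \<open>Smoothing \<open>\<pi>\<close> by Gaussians gives densities whose L2 norms are bounded
  uniformly in the width. Cauchy-Schwarz then bounds the smoothed mass of an open set by the square
  root of a constant times its Lebesgue measure. Fatou removes the smoothing, and outer regularity
  passes from open sets to \<open>Z\<close>.\<close>

lemma null_of_square_integrable_char:
  fixes \<pi> :: "'a::euclidean_space measure"
  assumes "prob_space \<pi>" and sets: "sets \<pi> = sets borel"
    and fin: "(\<integral>\<^sup>+\<tau>. ennreal ((norm (LINT x|\<pi>. cis (x \<bullet> \<tau>)))\<^sup>2) \<partial>lborel) < \<infinity>"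
    and Z: "Z \<in> null_sets lborel"
  shows "Z \<in> null_sets \<pi>"
proof -
  interpret prob_space \<pi> by fact
  interpret P: pair_sigma_finite \<pi> "lborel :: 'a measure" by standard
  note sets[measurable_cong]
  let ?n = "DIM('a)"
  define A where "A = enn2real (\<integral>\<^sup>+\<tau>. ennreal ((norm (LINT x|\<pi>. cis (x \<bullet> \<tau>)))\<^sup>2) \<partial>lborel)"
  have A: "(\<integral>\<^sup>+\<tau>. ennreal ((norm (LINT x|\<pi>. cis (x \<bullet> \<tau>)))\<^sup>2) \<partial>lborel) = ennreal A" "A \<ge> 0"
    using fin by (auto simp: A_def)
  \<comment> \<open>The density of the convolution of \<open>\<pi>\<close> with the Gaussian of
    parameter \<open>a\<close>.\<close>
  define q where "q a y = (\<integral>\<^sup>+x. ennreal (gauss_density a (y - x)) \<partial>\<pi>)" for a and y :: 'a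
  have qm[measurable]: "q a \<in> borel_measurable borel" for a
    unfolding q_def[abs_def] by measurable
  have q2: "(\<integral>\<^sup>+y. (q a y)\<^sup>2 \<partial>lborel) \<le> ennreal A" if a: "a > 0" for a
  proof -
    define b where "b = 1 / (2 * a)"
    have b: "b > 0" using a by (simp add: b_def)
    let ?g = "\<lambda>x y. ennreal (gauss_density a (y - x :: 'a))"
    let ?E = "\<integral>\<^sup>+x. \<integral>\<^sup>+x'. ennreal (exp (- (norm (x - x'))\<^sup>2 / (4 * b))) \<partial>\<pi> \<partial>\<pi>"
    have "(\<integral>\<^sup>+y. (q a y)\<^sup>2 \<partial>lborel) = (\<integral>\<^sup>+y. \<integral>\<^sup>+x. \<integral>\<^sup>+x'. ?g x y * ?g x' y \<partial>\<pi> \<partial>\<pi> \<partial>lborel)"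
      unfolding q_def power2_eq_square
      by (intro nn_integral_cong) (simp add: nn_integral_cmult nn_integral_multc)
    also have "\<dots> = (\<integral>\<^sup>+x. \<integral>\<^sup>+y. \<integral>\<^sup>+x'. ?g x y * ?g x' y \<partial>\<pi> \<partial>lborel \<partial>\<pi>)"
      by (rule P.Fubini') measurable
    also have "\<dots> = (\<integral>\<^sup>+x. \<integral>\<^sup>+x'. \<integral>\<^sup>+y. ?g x y * ?g x' y \<partial>lborel \<partial>\<pi> \<partial>\<pi>)"
      by (intro nn_integral_cong P.Fubini') measurable
    also have "\<dots> = ennreal (sqrt (a / (2 * pi)) ^ ?n) * ?E"
      unfolding gauss_density_correlation[OF a] b_def by (simp add: nn_integral_cmult)
    finally have 1: "(\<integral>\<^sup>+y. (q a y)\<^sup>2 \<partial>lborel) = ennreal (sqrt (a / (2 * pi)) ^ ?n) * ?E" .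
    have "ennreal (sqrt (pi / b) ^ ?n) * ?E = (\<integral>\<^sup>+\<eta>. ennreal (exp (- b * (norm \<eta>)\<^sup>2) * (norm (LINT z|\<pi>. cis (z \<bullet> \<eta>)))\<^sup>2) \<partial>lborel)"
      using b by (subst nn_integral_gaussian_square_eq[where \<xi>="\<lambda>x. x"]) (auto simp: finite_measure_axioms)
    also have "\<dots> \<le> ennreal A" unfolding A(1)[symmetric]
      using b by (intro nn_integral_mono ennreal_leI) (simp add: mult_left_le_one_le)
    finally have 2: "ennreal (sqrt (pi / b) ^ ?n) * ?E \<le> ennreal A" .
    \<comment> \<open>The exact ratio of the two sides is the Plancherel constant
      \<open>(2 * pi) ^ ?n\<close> for characters without a factor \<open>2 * pi\<close>; a bound by
      1 is enough.\<close>
    have "sqrt (a / (2 * pi)) ^ ?n \<le> sqrt (pi / b) ^ ?n"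
    proof (intro power_mono)
      have "1 \<le> (2 * pi) * (2 * pi)" using pi_gt3 mult_mono[of 1 "2 * pi" 1 "2 * pi"] by auto
      then have "a \<le> a * ((2 * pi) * (2 * pi))" using a by (simp add: mult_le_cancel_left1)
      then have "a / (2 * pi) \<le> pi / b" using a by (simp add: b_def field_simps)
      then show "sqrt (a / (2 * pi)) \<le> sqrt (pi / b)" by simp
    qed (use a in auto)
    then have "ennreal (sqrt (a / (2 * pi)) ^ ?n) * ?E \<le> ennreal (sqrt (pi / b) ^ ?n) * ?E"
      by (intro mult_right_mono ennreal_leI) auto
    then show ?thesis using 1 2 by simp
  qed
  have open_bound: "emeasure \<pi> U \<le> ennreal \<beta>" if U: "open U" and UA: "emeasure lborel U * ennreal A \<le> ennreal (\<beta>\<^sup>2)" and \<beta>: "\<beta> \<ge> 0" for U \<beta>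
  proof -
    have [measurable]: "U \<in> sets borel" using U by simp
    \<comment> \<open>The smoothing is written with one fixed Gaussian and shrinking shifts, so that
      the limit in \<open>j\<close> can be taken pointwise. The change of variables in
      \<open>up\<close> identifies it with parameter \<open>a = (Suc j)^2\<close>.\<close>
    let ?T = "\<lambda>j x v. indicator U (x + (1 / real (Suc j)) *\<^sub>R v) * ennreal (gauss_density 1 v)"
    have up: "(\<integral>\<^sup>+x. \<integral>\<^sup>+v. ?T j x v \<partial>lborel \<partial>\<pi>) \<le> ennreal \<beta>" for j
    proof -
      define c where "c = 1 / real (Suc j)"
      define a where "a = (real (Suc j))\<^sup>2"
      have a: "a > 0" and c: "c > 0" by (auto simp: a_def c_def)
      have gd: "gauss_density 1 v = \<bar>c\<bar> ^ ?n * gauss_density a (c *\<^sub>R v)" for v :: 'a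
      proof -
        have "sqrt (a / pi) = sqrt (1 / pi) / c" by (simp add: a_def c_def real_sqrt_divide)
        moreover have "a * (norm (c *\<^sub>R v))\<^sup>2 = (norm v)\<^sup>2" 
          by (simp add: a_def c_def power_mult_distrib power_divide)
        ultimately show ?thesis using c by (simp add: gauss_density_def power_divide)
      qed
      have "(\<integral>\<^sup>+v. ?T j x v \<partial>lborel) = (\<integral>\<^sup>+y. indicator U y * ennreal (gauss_density a (y - x)) \<partial>lborel)" for x
      proof -
        have "(\<integral>\<^sup>+y. indicator U y * ennreal (gauss_density a (y - x)) \<partial>lborel)
          = (\<integral>\<^sup>+v. ennreal (\<bar>c\<bar> ^ ?n) * (indicator U (x + c *\<^sub>R v) * ennreal (gauss_density a (x + c *\<^sub>R v - x))) \<partial>lborel)"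
          using c by (subst lborel_affine[of c x]) (auto simp: nn_integral_density nn_integral_distr)
        also have "\<dots> = (\<integral>\<^sup>+v. ?T j x v \<partial>lborel)"
          unfolding gd c_def[symmetric] using c a
          by (intro nn_integral_cong) (simp add: ennreal_mult gauss_density_nonneg mult_ac)
        finally show ?thesis by simp
      qed
      then have "(\<integral>\<^sup>+x. \<integral>\<^sup>+v. ?T j x v \<partial>lborel \<partial>\<pi>) = (\<integral>\<^sup>+x. \<integral>\<^sup>+y. indicator U y * ennreal (gauss_density a (y - x)) \<partial>lborel \<partial>\<pi>)"
        by simp
      also have "\<dots> = (\<integral>\<^sup>+y. \<integral>\<^sup>+x. indicator U y * ennreal (gauss_density a (y - x)) \<partial>\<pi> \<partial>lborel)"
        by (rule P.Fubini'[symmetric]) measurable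
      also have "\<dots> = (\<integral>\<^sup>+y. indicator U y * q a y \<partial>lborel)"
        unfolding q_def by (simp add: nn_integral_cmult)
      finally have eq: "(\<integral>\<^sup>+x. \<integral>\<^sup>+v. ?T j x v \<partial>lborel \<partial>\<pi>) = (\<integral>\<^sup>+y. indicator U y * q a y \<partial>lborel)" .
      have "(\<integral>\<^sup>+y. indicator U y * q a y \<partial>lborel)\<^sup>2 \<le> (\<integral>\<^sup>+y. (indicator U y)\<^sup>2 \<partial>lborel) * (\<integral>\<^sup>+y. (q a y)\<^sup>2 \<partial>lborel)"
        by (rule Cauchy_Schwarz_nn_integral) measurable
      also have "(\<lambda>y. (indicator U y)\<^sup>2 :: ennreal) = indicator U" by (auto simp: indicator_def)
      also have "(\<integral>\<^sup>+y. indicator U y \<partial>lborel) * (\<integral>\<^sup>+y. (q a y)\<^sup>2 \<partial>lborel) \<le> emeasure lborel U * ennreal A"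
        using q2[OF a] by (simp add: mult_left_mono)
      also have "\<dots> \<le> (ennreal \<beta>)\<^sup>2" using UA \<beta> by (simp add: ennreal_power)
      finally have "(\<integral>\<^sup>+y. indicator U y * q a y \<partial>lborel)\<^sup>2 \<le> (ennreal \<beta>)\<^sup>2" .
      then show ?thesis unfolding eq using \<beta>
        by (cases "\<integral>\<^sup>+y. indicator U y * q a y \<partial>lborel")
          (auto simp: ennreal_power power2_eq_square top_unique ennreal_mult_eq_top_iff
            intro!: ennreal_leI dest: power2_le_imp_le[unfolded power2_eq_square] simp flip: ennreal_mult)
    qed
    have "emeasure \<pi> U = (\<integral>\<^sup>+x. indicator U x * (\<integral>\<^sup>+v. ennreal (gauss_density 1 (v - 0 :: 'a)) \<partial>lborel) \<partial>\<pi>)"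
      by (subst nn_integral_gauss_density) (auto simp: sets)
    also have "\<dots> = (\<integral>\<^sup>+x. \<integral>\<^sup>+v. indicator U x * ennreal (gauss_density 1 (v::'a)) \<partial>lborel \<partial>\<pi>)"
      by (simp add: nn_integral_cmult)
    \<comment> \<open>Openness of \<open>U\<close> enters here: a point of \<open>U\<close> stays in
      \<open>U\<close> under all sufficiently small shifts. Two applications of Fatou
      follow.\<close>
    also have "\<dots> \<le> (\<integral>\<^sup>+x. \<integral>\<^sup>+v. liminf (\<lambda>j. ?T j x v) \<partial>lborel \<partial>\<pi>)"
    proof (intro nn_integral_mono)
      fix x v :: 'a
      show "indicator U x * ennreal (gauss_density 1 v) \<le> liminf (\<lambda>j. ?T j x v)"
      proof (cases "x \<in> U")
        case True
        have "(\<lambda>j. x + (1 / real (Suc j)) *\<^sub>R v) \<longlonglongrightarrow> x + 0 *\<^sub>R v"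
          by (intro tendsto_intros LIMSEQ_Suc[OF lim_1_over_n])
        then have "eventually (\<lambda>j. x + (1 / real (Suc j)) *\<^sub>R v \<in> U) sequentially"
          using True U by (auto dest: topological_tendstoD)
        then have "eventually (\<lambda>j. indicator U x * ennreal (gauss_density 1 v) \<le> ?T j x v) sequentially"
          by eventually_elim (simp add: True)
        then show ?thesis by (rule Liminf_bounded)
      qed simp
    qed
    also have "\<dots> \<le> (\<integral>\<^sup>+x. liminf (\<lambda>j. \<integral>\<^sup>+v. ?T j x v \<partial>lborel) \<partial>\<pi>)"
      by (intro nn_integral_mono nn_integral_liminf) measurable
    also have "\<dots> \<le> liminf (\<lambda>j. \<integral>\<^sup>+x. \<integral>\<^sup>+v. ?T j x v \<partial>lborel \<partial>\<pi>)"
      by (intro nn_integral_liminf) measurable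
    also have "\<dots> \<le> ennreal \<beta>"
      using up by (intro Liminf_le always_eventually) auto
    finally show ?thesis .
  qed
  have Zs: "Z \<in> sets borel" using Z by auto
  have "emeasure \<pi> Z \<le> 0"
  proof (rule ennreal_le_epsilon)
    fix e :: real assume e: "0 < e"
    \<comment> \<open>Adding 1 covers the case \<open>A = 0\<close>; the product of this measure
      with \<open>A\<close> stays below \<open>e^2\<close>.\<close>
    have "0 < e\<^sup>2 / (A + 1)" using e A(2) by simp
    then obtain U where U: "open U" "Z \<subseteq> U" "emeasure lborel (U - Z) < ennreal (e\<^sup>2 / (A + 1))"
      using outer_regular_lborel[OF Zs] by blast
    have "emeasure lborel U \<le> emeasure lborel (U - Z) + emeasure lborel Z"
      using U(1) Zs by (subst plus_emeasure) (auto intro!: emeasure_mono)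
    also have "\<dots> \<le> ennreal (e\<^sup>2 / (A + 1))" using Z U(3) by auto
    finally have "emeasure lborel U * ennreal A \<le> ennreal (e\<^sup>2 / (A + 1)) * ennreal A"
      by (intro mult_right_mono) auto
    also have "\<dots> = ennreal (e\<^sup>2 * (A / (A + 1)))" using A(2) by (simp flip: ennreal_mult)
    also have "\<dots> \<le> ennreal (e\<^sup>2)" using A(2) by (intro ennreal_leI mult_left_le) auto
    finally have "emeasure \<pi> U \<le> ennreal e" using open_bound[OF U(1)] e by auto
    moreover have "emeasure \<pi> Z \<le> emeasure \<pi> U" using U sets by (intro emeasure_mono) auto
    ultimately show "emeasure \<pi> Z \<le> 0 + ennreal e" by simp
  qed
  then show ?thesis using Zs sets by (auto simp: null_sets_def)
qed

section \<open>Oscillatory integrals over a Frostman measure\<close>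

text \<open>The ball condition is imposed at every centre, not only on the support, because it is
  also applied around the Lebesgue variable \<open>\<eta>\<close>. The radius \<open>R\<close> keeps
  the weight \<open>exp (|z|^2)\<close> bounded.\<close>

locale frostman_measure =
  fixes M :: "'a::euclidean_space measure" and C s R :: real
  assumes prob: "prob_space M" and sets_M [measurable_cong]: "sets M = sets borel"
    and s_pos: "s > 0" and C_pos: "C > 0" and R_nonneg: "R \<ge> 0"
    and bounded: "AE x in M. norm x \<le> R"
    and emeasure_cball_le: "\<And>x r. r > 0 \<Longrightarrow> emeasure M (cball x r) \<le> ennreal (C * r powr s)"
begin

sublocale prob_space M by (rule prob)

lemma summable_gauss_powr: "summable (\<lambda>j. exp (- (real j)\<^sup>2) * (real j + 1) powr s)"
proof -
  \<comment> \<open>With this \<open>c\<close>, the inequality \<open>ln u <= u - 1\<close> at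
    \<open>u = c * (j + 1)\<close> bounds \<open>s * ln (j + 1)\<close> by \<open>j / 2\<close> plus
    a constant. Since \<open>j <= j^2\<close>, a geometric series with ratio
    \<open>exp (-1/2)\<close> dominates.\<close>
  define c where "c = 1 / (2 * s)"
  define L where "L = exp (- s - s * ln c + 1 / 2)"
  have c: "c > 0" using s_pos by (simp add: c_def)
  have le: "exp (- (real j)\<^sup>2) * (real j + 1) powr s \<le> L * (exp (- 1 / 2)) ^ j" for j
  proof -
    have "ln (c * (real j + 1)) \<le> c * (real j + 1) - 1"
      using c by (intro ln_le_minus_one) simp
    then have "s * (ln c + ln (real j + 1)) \<le> s * (c * (real j + 1) - 1)"
      using c s_pos by (subst (asm) ln_mult) (auto intro!: mult_left_mono)
    then have 1: "s * ln (real j + 1) \<le> - s - s * ln c + 1 / 2 + real j / 2"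
    proof -
      have sc: "s * c = 1 / 2" using s_pos by (simp add: c_def)
      have "s * (c * (real j + 1) - 1) = (s * c) * (real j + 1) - s" by (simp add: algebra_simps)
      with \<open>s * (ln c + ln (real j + 1)) \<le> s * (c * (real j + 1) - 1)\<close> show ?thesis
        unfolding sc by (simp add: algebra_simps)
    qed
    have "real j \<le> (real j)\<^sup>2" by (cases j) (auto simp: power2_eq_square)
    then have "- (real j)\<^sup>2 + s * ln (real j + 1) \<le> (- s - s * ln c + 1 / 2) + real j * (- 1 / 2)"
      using 1 by linarith
    then have "exp (- (real j)\<^sup>2 + s * ln (real j + 1)) \<le> exp ((- s - s * ln c + 1 / 2) + real j * (- 1 / 2))"
      by simp
    then show ?thesis
      unfolding exp_add exp_of_nat_mult L_def by (simp add: powr_def exp_of_nat_mult)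
  qed
  have "summable (\<lambda>j. L * (exp (- 1 / 2 :: real)) ^ j)"
    by (intro summable_mult summable_geometric) simp
  then show ?thesis
    by (rule summable_comparison_test'[where N = 0]) (use le in simp)
qed

definition gauss_const :: real where
  "gauss_const = C * (\<Sum>j. exp (- (real j)\<^sup>2) * (real j + 1) powr s)"

lemma gauss_const_nonneg: "gauss_const \<ge> 0"
  unfolding gauss_const_def using C_pos by (intro mult_nonneg_nonneg suminf_nonneg summable_gauss_powr) auto

text \<open>On the shell where \<open>t * |x - y|\<close> lies between \<open>j\<close> and
  \<open>j + 1\<close>, the Gaussian is at most \<open>exp (-j^2)\<close> and the shell sits in a
  ball of radius \<open>(j + 1) / t\<close>. Summing the Frostman bounds over \<open>j\<close>
  produces \<open>gauss_const\<close>.\<close>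

lemma gauss_integral_le:
  assumes t: "t > 0"
  shows "(\<integral>\<^sup>+y. ennreal (exp (- (t * norm (x - y))\<^sup>2)) \<partial>M) \<le> ennreal (gauss_const * t powr - s)"
proof -
  let ?b = "\<lambda>j y. ennreal (exp (- (real j)\<^sup>2)) * indicator (cball x ((real j + 1) / t)) y"
  have "(\<integral>\<^sup>+y. ennreal (exp (- (t * norm (x - y))\<^sup>2)) \<partial>M) \<le> (\<integral>\<^sup>+y. (\<Sum>j. ?b j y) \<partial>M)"
  proof (rule nn_integral_mono)
    fix y
    define u where "u = t * norm (x - y)"
    define j where "j = nat \<lfloor>u\<rfloor>"
    have u: "u \<ge> 0" using t by (simp add: u_def)
    then have j: "real j \<le> u" "u \<le> real j + 1" unfolding j_def by linarith+
    have "norm (x - y) \<le> (real j + 1) / t" using j(2) t by (simp add: u_def field_simps)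
    then have "y \<in> cball x ((real j + 1) / t)" by (simp add: dist_norm)
    moreover have "exp (- u\<^sup>2) \<le> exp (- (real j)\<^sup>2)" using j(1) by (simp add: power_mono)
    ultimately have "ennreal (exp (- u\<^sup>2)) \<le> ?b j y" by (simp add: ennreal_leI)
    also have "\<dots> = (\<Sum>i\<in>{j}. ?b i y)" by (subst sum.insert) simp_all
    also have "\<dots> \<le> (\<Sum>j. ?b j y)" by (intro sum_le_suminf) auto
    finally show "ennreal (exp (- (t * norm (x - y))\<^sup>2)) \<le> (\<Sum>j. ?b j y)" by (simp add: u_def)
  qed
  also have "\<dots> = (\<Sum>j. \<integral>\<^sup>+y. ?b j y \<partial>M)" 
    by (rule nn_integral_suminf) (auto simp: sets_M intro!: borel_measurable_times_ennreal borel_measurable_indicator)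
  also have "\<dots> = (\<Sum>j. ennreal (exp (- (real j)\<^sup>2)) * emeasure M (cball x ((real j + 1) / t)))"
    by (simp add: nn_integral_cmult_indicator sets_M)
  also have "\<dots> \<le> (\<Sum>j. ennreal (C * t powr - s * (exp (- (real j)\<^sup>2) * (real j + 1) powr s)))"
  proof (intro suminf_le)
    fix j
    have "emeasure M (cball x ((real j + 1) / t)) \<le> ennreal (C * ((real j + 1) / t) powr s)"
      using t by (intro emeasure_cball_le) simp
    then have "ennreal (exp (- (real j)\<^sup>2)) * emeasure M (cball x ((real j + 1) / t))
       \<le> ennreal (exp (- (real j)\<^sup>2)) * ennreal (C * ((real j + 1) / t) powr s)" by (rule mult_left_mono) simp
    also have "\<dots> = ennreal (C * t powr - s * (exp (- (real j)\<^sup>2) * (real j + 1) powr s))"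
      using t C_pos by (simp add: powr_divide powr_minus_divide field_simps flip: ennreal_mult)
    finally show "ennreal (exp (- (real j)\<^sup>2)) * emeasure M (cball x ((real j + 1) / t)) \<le> ennreal (C * t powr - s * (exp (- (real j)\<^sup>2) * (real j + 1) powr s))" .
  qed auto
  also have "\<dots> = ennreal (\<Sum>j. C * t powr - s * (exp (- (real j)\<^sup>2) * (real j + 1) powr s))"
    using C_pos by (intro suminf_ennreal2 summable_mult summable_gauss_powr) auto
  also have "(\<Sum>j. C * t powr - s * (exp (- (real j)\<^sup>2) * (real j + 1) powr s)) = gauss_const * t powr - s"
    unfolding gauss_const_def by (subst suminf_mult[OF summable_gauss_powr]) (simp add: mult_ac)
  finally show ?thesis .
qed

text \<open>A modulated measure has a Fourier transform that, at scale \<open>1 / \<tau>\<close>, is a Gaussian average of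
  its neighbouring values (the weight \<open>exp (|z|\<^sup>2)\<close> undoes the damping); this replaces evaluation on the
  singular measure by integration in Lebesgue measure, where Plancherel applies.\<close>

lemma gaussian_average:
  assumes \<theta>[measurable]: "\<theta> \<in> borel_measurable borel" and \<tau>: "\<tau> \<noteq> 0"
  defines "h \<equiv> \<lambda>z. if norm z \<le> R then exp ((norm z)\<^sup>2) *\<^sub>R cis (\<theta> z) else 0"
  defines "H \<equiv> \<lambda>\<eta>. LINT z|M. h z * cis ((2 * \<tau>) *\<^sub>R z \<bullet> \<eta>)"
  shows "has_bochner_integral lborel (\<lambda>\<eta>. exp (- \<tau>\<^sup>2 * (norm (\<eta> - y))\<^sup>2) *\<^sub>R H \<eta>)
    (sqrt (pi / \<tau>\<^sup>2) ^ DIM('a) *\<^sub>R (LINT z|M. cis (\<theta> z + 2 * \<tau> * (z \<bullet> y))))"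
proof -
  interpret P: pair_sigma_finite "lborel :: 'a measure" M by standard
  have \<tau>2: "\<tau>\<^sup>2 > 0" using \<tau> by simp
  have [measurable]: "h \<in> borel_measurable borel" unfolding h_def by measurable
  have hb: "norm (h z) \<le> exp (R\<^sup>2)" for z
    by (auto simp: h_def norm_mult power_mono)
  define F where "F = (\<lambda>(\<eta>, z). exp (- \<tau>\<^sup>2 * (norm (\<eta> - y))\<^sup>2) *\<^sub>R (h z * cis ((2 * \<tau>) *\<^sub>R z \<bullet> \<eta>)))"
  have Fm[measurable]: "F \<in> borel_measurable (lborel \<Otimes>\<^sub>M M)" unfolding F_def by measurable
  have ih: "integrable M (\<lambda>z. h z * cis ((2 * \<tau>) *\<^sub>R z \<bullet> \<eta>))" for \<eta>
    using hb by (intro integrable_const_bound[of _ "exp (R\<^sup>2)"]) (auto simp: norm_mult)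
  have g: "integrable lborel (\<lambda>\<eta>::'a. exp (- \<tau>\<^sup>2 * (norm (\<eta> - y))\<^sup>2))"
    using gaussian_fourier_shift[OF \<tau>2, of y 0] by (simp add: has_bochner_integral_iff complex_of_real_integrable_eq)
  have iF: "integrable (lborel \<Otimes>\<^sub>M M) F"
  proof (rule P.Fubini_integrable[OF Fm])
    have "(LINT z|M. norm (F (\<eta>, z))) = exp (- \<tau>\<^sup>2 * (norm (\<eta> - y))\<^sup>2) * (LINT z|M. norm (h z))" for \<eta>
      unfolding F_def by (simp add: norm_mult)
    then show "integrable lborel (\<lambda>\<eta>. LINT z|M. norm (F (\<eta>, z)))"
      using g by (simp only: integrable_mult_left)
  qed (use ih in \<open>auto simp: F_def\<close>)
  have FH: "(LINT z|M. F (\<eta>, z)) = exp (- \<tau>\<^sup>2 * (norm (\<eta> - y))\<^sup>2) *\<^sub>R H \<eta>" for \<eta>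
    unfolding F_def H_def by (simp del: scaleR_conv_of_real inner_scaleR_left)
  have "integrable lborel (\<lambda>\<eta>. LINT z|M. F (\<eta>, z))" using P.integrable_fst'[OF iF] .
  then have 1: "integrable lborel (\<lambda>\<eta>. exp (- \<tau>\<^sup>2 * (norm (\<eta> - y))\<^sup>2) *\<^sub>R H \<eta>)" unfolding FH .
  have "(LINT \<eta>|lborel. exp (- \<tau>\<^sup>2 * (norm (\<eta> - y))\<^sup>2) *\<^sub>R H \<eta>) = (LINT z|M. LINT \<eta>|lborel. F (\<eta>, z))"
    unfolding FH[symmetric] using P.Fubini_integral[of "\<lambda>\<eta> z. F (\<eta>, z)"] iF by simp
  also have "\<dots> = (LINT z|M. sqrt (pi / \<tau>\<^sup>2) ^ DIM('a) *\<^sub>R cis (\<theta> z + 2 * \<tau> * (z \<bullet> y)))"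
  proof (rule integral_cong_AE)
    show "AE z in M. (LINT \<eta>|lborel. F (\<eta>, z)) = sqrt (pi / \<tau>\<^sup>2) ^ DIM('a) *\<^sub>R cis (\<theta> z + 2 * \<tau> * (z \<bullet> y))"
      using bounded
    proof eventually_elim
      fix z :: 'a assume z: "norm z \<le> R"
      \<comment> \<open>Window width and frequency are matched so that the damping does not depend
        on \<open>\<tau>\<close>; hence one bounded weight undoes it at every scale.\<close>
      have e: "(norm ((2 * \<tau>) *\<^sub>R z))\<^sup>2 / (4 * \<tau>\<^sup>2) = (norm z)\<^sup>2"
        using \<tau> by (simp add: power_mult_distrib)
      have "(LINT \<eta>|lborel. F (\<eta>, z)) = h z * (cis ((2 * \<tau>) *\<^sub>R z \<bullet> y) * of_real (sqrt (pi / \<tau>\<^sup>2) ^ DIM('a) * exp (- ((norm ((2 * \<tau>) *\<^sub>R z))\<^sup>2 / (4 * \<tau>\<^sup>2)))))"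
        using gaussian_fourier_shift[OF \<tau>2, of y "(2 * \<tau>) *\<^sub>R z", THEN has_bochner_integral_mult_right, of "h z"]
        unfolding F_def has_bochner_integral_iff by (simp add: scaleR_conv_of_real mult_ac)
      also have "\<dots> = of_real (sqrt (pi / \<tau>\<^sup>2) ^ DIM('a)) * (of_real (exp ((norm z)\<^sup>2) * exp (- (norm z)\<^sup>2)) * (cis (\<theta> z) * cis (2 * \<tau> * (z \<bullet> y))))"
        unfolding e using z by (simp add: h_def scaleR_conv_of_real mult_ac)
      also have "exp ((norm z)\<^sup>2) * exp (- (norm z)\<^sup>2) = 1" by (simp flip: exp_add)
      finally show "(LINT \<eta>|lborel. F (\<eta>, z)) = sqrt (pi / \<tau>\<^sup>2) ^ DIM('a) *\<^sub>R cis (\<theta> z + 2 * \<tau> * (z \<bullet> y))"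
        by (simp add: scaleR_conv_of_real cis_mult)
    qed
  qed measurable
  also have "\<dots> = sqrt (pi / \<tau>\<^sup>2) ^ DIM('a) *\<^sub>R (LINT z|M. cis (\<theta> z + 2 * \<tau> * (z \<bullet> y)))" by simp
  finally show ?thesis using 1 by (simp add: has_bochner_integral_iff)
qed

text \<open>In order: the loss in splitting the window, the squared bound on the weight
  \<open>h\<close>, the Plancherel constant for parameter \<open>1/4\<close>, the two Frostman
  bounds with their scales \<open>|\<tau>| / sqrt 2\<close> and \<open>2 * |\<tau>|\<close>, and the
  normalisation of the window.\<close>

definition osc_const :: real where
  "osc_const = exp (R\<^sup>2 / 2) * (exp (R\<^sup>2))\<^sup>2 * sqrt (4 * pi) ^ DIM('a) * gauss_const\<^sup>2 * sqrt 2 powr s * 2 powr - s / sqrt pi ^ DIM('a)"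

lemma osc_const_nonneg: "osc_const \<ge> 0"
  by (simp add: osc_const_def)

text \<open>The phase \<open>\<theta>\<close> is arbitrary: it disappears into the modulation
  \<open>h\<close>, and only the bilinear term yields decay. The weights \<open>-s\<close> come from
  Plancherel for \<open>H\<close> and from the mass of \<open>M\<close> near \<open>\<eta>\<close>;
  dividing by \<open>Z\<close>, of order \<open>|\<tau>|^(-d)\<close>, gives the remaining
  power.\<close>

lemma oscillatory_square_estimate:
  assumes \<theta>[measurable]: "\<theta> \<in> borel_measurable borel" and \<tau>: "\<bar>\<tau>\<bar> \<ge> 1"
  shows "(\<integral>\<^sup>+y. ennreal ((norm (LINT z|M. cis (\<theta> z + 2 * \<tau> * (z \<bullet> y))))\<^sup>2) \<partial>M)
    \<le> ennreal (osc_const * \<bar>\<tau>\<bar> powr (DIM('a) - 2 * s))"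
proof -
  interpret P: pair_sigma_finite M "lborel :: 'a measure" by standard
  let ?n = "DIM('a)"
  define h where "h z = (if norm z \<le> R then exp ((norm z)\<^sup>2) *\<^sub>R cis (\<theta> z) else 0)" for z
  define H where "H \<eta> = (LINT z|M. h z * cis ((2 * \<tau>) *\<^sub>R z \<bullet> \<eta>))" for \<eta>
  define F where "F y = (LINT z|M. cis (\<theta> z + 2 * \<tau> * (z \<bullet> y)))" for y
  define Z where "Z = sqrt (pi / \<tau>\<^sup>2) ^ ?n"
  have \<tau>0: "\<tau> \<noteq> 0" "\<bar>\<tau>\<bar> > 0" and \<tau>2: "\<tau>\<^sup>2 > 0" using \<tau> by auto
  have \<tau>21: "\<tau>\<^sup>2 \<ge> 1" using power_mono[OF \<tau>, of 2] by simp
  have Z: "Z > 0" using \<tau>2 by (simp add: Z_def)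
  have [measurable]: "h \<in> borel_measurable borel" unfolding h_def[abs_def] by measurable
  have hb: "norm (h z) \<le> exp (R\<^sup>2)" for z
    by (auto simp: h_def norm_mult power_mono)
  have Hm[measurable]: "H \<in> borel_measurable borel" unfolding H_def[abs_def] by measurable
  have Fm[measurable]: "F \<in> borel_measurable borel" unfolding F_def[abs_def] by measurable
  let ?g = "\<lambda>y \<eta>. exp (- \<tau>\<^sup>2 * (norm (\<eta> - y :: 'a))\<^sup>2)"
  have pt: "ennreal ((norm (F y))\<^sup>2) * ennreal Z \<le> (\<integral>\<^sup>+\<eta>. ennreal ((norm (H \<eta>))\<^sup>2 * ?g y \<eta>) \<partial>lborel)" for y
  proof -
    \<comment> \<open>The square root of the window. Cauchy-Schwarz with the window split into two
      such factors leaves a single \<open>Z\<close> after cancellation.\<close>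
    let ?r = "\<lambda>\<eta>. ennreal (exp (- (\<tau>\<^sup>2 * (norm (\<eta> - y))\<^sup>2) / 2))"
    have rr: "?r \<eta> * ?r \<eta> = ennreal (?g y \<eta>)" for \<eta>
      by (simp add: exp_add[symmetric] flip: ennreal_mult)
    have rr2: "(?r \<eta>)\<^sup>2 = ennreal (?g y \<eta>)" for \<eta>
      by (rule trans[OF power2_eq_square rr])
    have nrm: "ennreal (norm (?g y \<eta> *\<^sub>R H \<eta>)) = (ennreal (norm (H \<eta>)) * ?r \<eta>) * ?r \<eta>" for \<eta>
    proof -
      have "norm (?g y \<eta> *\<^sub>R H \<eta>) = norm (H \<eta>) * ?g y \<eta>" by simp
      then show ?thesis by (simp only: mult.assoc rr ennreal_mult norm_ge_zero exp_ge_zero)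
    qed
    note ga = gaussian_average[OF \<theta> \<tau>0(1), of y, folded h_def, folded H_def F_def Z_def]
    have "ennreal (norm (Z *\<^sub>R F y)) \<le> (\<integral>\<^sup>+\<eta>. ennreal (norm (?g y \<eta> *\<^sub>R H \<eta>)) \<partial>lborel)"
      using integral_norm_bound_ennreal[of lborel "\<lambda>\<eta>. ?g y \<eta> *\<^sub>R H \<eta>"] ga
      by (simp only: has_bochner_integral_iff)
    also have "\<dots> = (\<integral>\<^sup>+\<eta>. (ennreal (norm (H \<eta>)) * ?r \<eta>) * ?r \<eta> \<partial>lborel)"
      unfolding nrm ..
    finally have "ennreal (Z * norm (F y)) \<le> (\<integral>\<^sup>+\<eta>. (ennreal (norm (H \<eta>)) * ?r \<eta>) * ?r \<eta> \<partial>lborel)"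
      using Z by simp
    then have "(ennreal (Z * norm (F y)))\<^sup>2 \<le> (\<integral>\<^sup>+\<eta>. (ennreal (norm (H \<eta>)) * ?r \<eta>) * ?r \<eta> \<partial>lborel)\<^sup>2"
      by (rule power_mono) simp
    also have "\<dots> \<le> (\<integral>\<^sup>+\<eta>. (ennreal (norm (H \<eta>)) * ?r \<eta>)\<^sup>2 \<partial>lborel) * (\<integral>\<^sup>+\<eta>. (?r \<eta>)\<^sup>2 \<partial>lborel)"
      by (rule Cauchy_Schwarz_nn_integral) measurable
    also have "(\<integral>\<^sup>+\<eta>. (?r \<eta>)\<^sup>2 \<partial>lborel) = ennreal Z"
      unfolding rr2 Z_def by (rule nn_integral_gaussian[OF \<tau>2])
    also have "(\<lambda>\<eta>. (ennreal (norm (H \<eta>)) * ?r \<eta>)\<^sup>2) = (\<lambda>\<eta>. ennreal ((norm (H \<eta>))\<^sup>2 * ?g y \<eta>))"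
      unfolding power_mult_distrib rr2 by (simp only: ennreal_power ennreal_mult zero_le_power2 exp_ge_zero norm_ge_zero)
    finally have "(ennreal (Z * norm (F y)))\<^sup>2 \<le> (\<integral>\<^sup>+\<eta>. ennreal ((norm (H \<eta>))\<^sup>2 * ?g y \<eta>) \<partial>lborel) * ennreal Z" .
    then have "(ennreal (Z * norm (F y)))\<^sup>2 * ennreal (1 / Z) \<le> (\<integral>\<^sup>+\<eta>. ennreal ((norm (H \<eta>))\<^sup>2 * ?g y \<eta>) \<partial>lborel) * ennreal Z * ennreal (1 / Z)"
      by (rule mult_right_mono) simp
    moreover have "ennreal Z * ennreal (1 / Z) = 1" using Z by (simp flip: ennreal_mult)
    moreover have "(ennreal (Z * norm (F y)))\<^sup>2 * ennreal (1 / Z) = ennreal ((norm (F y))\<^sup>2) * ennreal Z"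
      using Z by (simp add: ennreal_power power2_eq_square field_simps flip: ennreal_mult)
    ultimately show ?thesis by (simp add: mult.assoc)
  qed
  let ?w = "\<lambda>\<eta>::'a. exp (- (1/4) * (norm \<eta>)\<^sup>2) * (norm (H \<eta>))\<^sup>2"
  let ?k = "\<lambda>\<eta> y. exp (- (\<bar>\<tau>\<bar> / sqrt 2 * norm (\<eta> - y))\<^sup>2)"
  \<comment> \<open>Half of the exponent keeps \<open>\<eta>\<close> near \<open>y\<close>. The
    other half, weakened by \<open>|\<tau>| >= 1\<close>, is traded for decay in
    \<open>\<eta>\<close> alone, which the Plancherel lemma requires;
    \<open>|\<eta>|^2 <= 2 |\<eta> - y|^2 + 2 |y|^2\<close> makes the rate
    \<open>1/4\<close>.\<close>
  have split: "?g y \<eta> \<le> exp (R\<^sup>2 / 2) * (exp (- (1/4) * (norm \<eta>)\<^sup>2) * ?k \<eta> y)" if y: "norm y \<le> R" for y \<eta>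
  proof -
    have "norm \<eta> \<le> norm (\<eta> - y) + norm y" by (metis diff_add_cancel norm_triangle_ineq)
    then have "(norm \<eta>)\<^sup>2 \<le> (norm (\<eta> - y) + norm y)\<^sup>2" by (simp add: power_mono)
    also have "\<dots> \<le> 2 * (norm (\<eta> - y))\<^sup>2 + 2 * (norm y)\<^sup>2"
      using zero_le_power2[of "norm (\<eta> - y) - norm y"] by (simp add: power2_eq_square algebra_simps)
    also have "(norm y)\<^sup>2 \<le> R\<^sup>2" using y by (simp add: power_mono)
    finally have "(norm \<eta>)\<^sup>2 / 4 \<le> (norm (\<eta> - y))\<^sup>2 / 2 + R\<^sup>2 / 2" by simp
    moreover have "1 * (norm (\<eta> - y))\<^sup>2 \<le> \<tau>\<^sup>2 * (norm (\<eta> - y))\<^sup>2" using \<tau>21 by (intro mult_right_mono) auto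
    moreover have "(\<bar>\<tau>\<bar> / sqrt 2 * norm (\<eta> - y))\<^sup>2 = \<tau>\<^sup>2 * (norm (\<eta> - y))\<^sup>2 / 2"
      by (simp add: power_mult_distrib power_divide)
    ultimately have "- \<tau>\<^sup>2 * (norm (\<eta> - y))\<^sup>2 \<le> R\<^sup>2 / 2 + (- (1/4) * (norm \<eta>)\<^sup>2 + - (\<bar>\<tau>\<bar> / sqrt 2 * norm (\<eta> - y))\<^sup>2)"
      by simp
    then show ?thesis unfolding exp_add[symmetric] by simp
  qed
  \<comment> \<open>First use of the Frostman bound: with parameter \<open>1/4\<close> the pair
    energy is the integral of \<open>exp (- |2 \<tau> (z - z')|^2)\<close>.\<close>
  have w: "(\<integral>\<^sup>+\<eta>. ennreal (?w \<eta>) \<partial>lborel) \<le> ennreal ((exp (R\<^sup>2))\<^sup>2 * sqrt (4 * pi) ^ ?n * (gauss_const * (2 * \<bar>\<tau>\<bar>) powr - s))"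
  proof -
    have "(\<integral>\<^sup>+\<eta>. ennreal (?w \<eta>) \<partial>lborel) \<le> ennreal ((exp (R\<^sup>2))\<^sup>2 * sqrt (pi / (1/4)) ^ ?n) *
        (\<integral>\<^sup>+z. \<integral>\<^sup>+z'. ennreal (exp (- (norm ((2 * \<tau>) *\<^sub>R z - (2 * \<tau>) *\<^sub>R z'))\<^sup>2 / (4 * (1/4)))) \<partial>M \<partial>M)"
      unfolding H_def by (intro nn_integral_gaussian_square_le hb finite_measure_axioms) (auto simp: sets_M)
    also have "\<dots> \<le> ennreal ((exp (R\<^sup>2))\<^sup>2 * sqrt (pi / (1/4)) ^ ?n) * (\<integral>\<^sup>+z. ennreal (gauss_const * (2 * \<bar>\<tau>\<bar>) powr - s) \<partial>M)"
    proof (intro mult_left_mono nn_integral_mono)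
      fix z :: 'a
      have "norm ((2 * \<tau>) *\<^sub>R z - (2 * \<tau>) *\<^sub>R z') = 2 * \<bar>\<tau>\<bar> * norm (z - z')" for z' :: 'a
        by (simp add: abs_mult flip: scaleR_right_diff_distrib)
      then show "(\<integral>\<^sup>+z'. ennreal (exp (- (norm ((2 * \<tau>) *\<^sub>R z - (2 * \<tau>) *\<^sub>R z'))\<^sup>2 / (4 * (1/4)))) \<partial>M) \<le> ennreal (gauss_const * (2 * \<bar>\<tau>\<bar>) powr - s)"
        using gauss_integral_le[of "2 * \<bar>\<tau>\<bar>" z] \<tau>0 by simp
    qed simp
    also have "\<dots> = ennreal ((exp (R\<^sup>2))\<^sup>2 * sqrt (4 * pi) ^ ?n * (gauss_const * (2 * \<bar>\<tau>\<bar>) powr - s))"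
      using gauss_const_nonneg by (subst nn_integral_const) (simp only: emeasure_space_1 mult_1_right ennreal_mult[symmetric] zero_le_mult_iff, simp add: mult.commute ennreal_mult)
    finally show ?thesis .
  qed
  have "(\<integral>\<^sup>+y. ennreal ((norm (F y))\<^sup>2) \<partial>M) * ennreal Z = (\<integral>\<^sup>+y. ennreal ((norm (F y))\<^sup>2) * ennreal Z \<partial>M)"
    by (rule nn_integral_multc[symmetric]) measurable
  also have "\<dots> \<le> (\<integral>\<^sup>+y. \<integral>\<^sup>+\<eta>. ennreal (exp (R\<^sup>2 / 2)) * (ennreal (?w \<eta>) * ennreal (?k \<eta> y)) \<partial>lborel \<partial>M)"
    using bounded
  proof (intro nn_integral_mono_AE, eventually_elim)
    fix y :: 'a assume y: "norm y \<le> R"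
    have "ennreal ((norm (H \<eta>))\<^sup>2 * ?g y \<eta>) \<le> ennreal (exp (R\<^sup>2 / 2)) * (ennreal (?w \<eta>) * ennreal (?k \<eta> y))" for \<eta>
    proof -
      have "(norm (H \<eta>))\<^sup>2 * ?g y \<eta> \<le> (norm (H \<eta>))\<^sup>2 * (exp (R\<^sup>2 / 2) * (exp (- (1/4) * (norm \<eta>)\<^sup>2) * ?k \<eta> y))"
        by (intro mult_left_mono split y) simp
      then show ?thesis by (simp add: ennreal_leI mult_ac flip: ennreal_mult)
    qed
    then show "ennreal ((norm (F y))\<^sup>2) * ennreal Z \<le> (\<integral>\<^sup>+\<eta>. ennreal (exp (R\<^sup>2 / 2)) * (ennreal (?w \<eta>) * ennreal (?k \<eta> y)) \<partial>lborel)"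
      by (intro order_trans[OF pt] nn_integral_mono)
  qed
  also have "\<dots> = (\<integral>\<^sup>+\<eta>. \<integral>\<^sup>+y. ennreal (exp (R\<^sup>2 / 2)) * (ennreal (?w \<eta>) * ennreal (?k \<eta> y)) \<partial>M \<partial>lborel)"
    by (rule P.Fubini'[symmetric]) measurable
  also have "\<dots> = ennreal (exp (R\<^sup>2 / 2)) * (\<integral>\<^sup>+\<eta>. ennreal (?w \<eta>) * (\<integral>\<^sup>+y. ennreal (?k \<eta> y) \<partial>M) \<partial>lborel)"
    by (simp add: nn_integral_cmult)
  also have "\<dots> \<le> ennreal (exp (R\<^sup>2 / 2)) * (\<integral>\<^sup>+\<eta>. ennreal (?w \<eta>) * ennreal (gauss_const * (\<bar>\<tau>\<bar> / sqrt 2) powr - s) \<partial>lborel)"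
    using \<tau>0 by (intro mult_left_mono nn_integral_mono gauss_integral_le) auto
  also have "\<dots> = ennreal (exp (R\<^sup>2 / 2)) * ((\<integral>\<^sup>+\<eta>. ennreal (?w \<eta>) \<partial>lborel) * ennreal (gauss_const * (\<bar>\<tau>\<bar> / sqrt 2) powr - s))"
    by (simp add: nn_integral_multc)
  also have "\<dots> \<le> ennreal (exp (R\<^sup>2 / 2)) * (ennreal ((exp (R\<^sup>2))\<^sup>2 * sqrt (4 * pi) ^ ?n * (gauss_const * (2 * \<bar>\<tau>\<bar>) powr - s)) * ennreal (gauss_const * (\<bar>\<tau>\<bar> / sqrt 2) powr - s))"
    by (intro mult_left_mono mult_right_mono w) auto
  also have "\<dots> = ennreal (exp (R\<^sup>2 / 2) * ((exp (R\<^sup>2))\<^sup>2 * sqrt (4 * pi) ^ ?n * (gauss_const * (2 * \<bar>\<tau>\<bar>) powr - s)) * (gauss_const * (\<bar>\<tau>\<bar> / sqrt 2) powr - s))"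
    using gauss_const_nonneg by (simp add: mult.assoc flip: ennreal_mult)
  also have "\<dots> = ennreal (osc_const * \<bar>\<tau>\<bar> powr (?n - 2 * s) * Z)"
  proof -
    have a: "(2 * \<bar>\<tau>\<bar>) powr - s * (\<bar>\<tau>\<bar> / sqrt 2) powr - s = (2 powr - s * sqrt 2 powr s) * \<bar>\<tau>\<bar> powr (- 2 * s)"
    proof -
      have "\<bar>\<tau>\<bar> powr (- 2 * s) = \<bar>\<tau>\<bar> powr - s * \<bar>\<tau>\<bar> powr - s" by (simp flip: powr_add)
      moreover have "sqrt 2 powr s * sqrt 2 powr - s = 1" by (simp flip: powr_add)
      ultimately show ?thesis using \<tau>0 by (simp add: powr_mult powr_divide field_simps)
    qed
    have "\<bar>\<tau>\<bar> powr (?n - 2 * s) = \<bar>\<tau>\<bar> ^ ?n * \<bar>\<tau>\<bar> powr (- 2 * s)"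
      using \<tau>0 by (simp add: powr_diff powr_realpow powr_minus_divide)
    moreover have "Z = sqrt pi ^ ?n / \<bar>\<tau>\<bar> ^ ?n"
      by (simp add: Z_def real_sqrt_divide power_divide)
    ultimately have b: "osc_const * \<bar>\<tau>\<bar> powr (?n - 2 * s) * Z = osc_const * sqrt pi ^ ?n * \<bar>\<tau>\<bar> powr (- 2 * s)"
      using \<tau>0 by simp
    have c: "osc_const * sqrt pi ^ ?n = exp (R\<^sup>2 / 2) * (exp (R\<^sup>2))\<^sup>2 * sqrt (4 * pi) ^ ?n * gauss_const\<^sup>2 * (2 powr - s * sqrt 2 powr s)"
      by (simp add: osc_const_def)
    have "exp (R\<^sup>2 / 2) * ((exp (R\<^sup>2))\<^sup>2 * sqrt (4 * pi) ^ ?n * (gauss_const * (2 * \<bar>\<tau>\<bar>) powr - s)) * (gauss_const * (\<bar>\<tau>\<bar> / sqrt 2) powr - s)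
      = (exp (R\<^sup>2 / 2) * (exp (R\<^sup>2))\<^sup>2 * sqrt (4 * pi) ^ ?n * gauss_const\<^sup>2) * ((2 * \<bar>\<tau>\<bar>) powr - s * (\<bar>\<tau>\<bar> / sqrt 2) powr - s)"
      by (simp only: power2_eq_square[of gauss_const] mult_ac)
    also have "\<dots> = osc_const * \<bar>\<tau>\<bar> powr (?n - 2 * s) * Z"
      unfolding a b c by (simp only: mult.assoc)
    finally show ?thesis by (rule arg_cong)
  qed
  also have "\<dots> = ennreal (osc_const * \<bar>\<tau>\<bar> powr (?n - 2 * s)) * ennreal Z"
    using Z osc_const_nonneg by (intro ennreal_mult mult_nonneg_nonneg powr_ge_zero) simp_all
  finally have "(\<integral>\<^sup>+y. ennreal ((norm (F y))\<^sup>2) \<partial>M) * ennreal Z * ennreal (1 / Z) \<le> ennreal (osc_const * \<bar>\<tau>\<bar> powr (?n - 2 * s)) * ennreal Z * ennreal (1 / Z)"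
    by (rule mult_right_mono) simp
  moreover have "ennreal Z * ennreal (1 / Z) = 1" using Z by (simp flip: ennreal_mult)
  ultimately show ?thesis unfolding F_def by (simp only: mult.assoc mult_1_right)
qed

end

section \<open>Characteristic functions of squared distances to random points\<close>

context frostman_measure
begin

lemma product_sigma_finite_M: "product_sigma_finite (\<lambda>_. M)"
  by standard

text \<open>Only the endpoint belonging to the largest frequency is averaged, with all others fixed.
  The product form on the right is what factors over the coordinates when \<open>\<tau>\<close> is
  integrated; \<open>\<gamma>\<close> is the share of the total decay given to each edge.\<close>

lemma pinned_char_square_estimate:
  fixes \<tau> :: "'e \<Rightarrow> real" and p :: "'e \<Rightarrow> 'v" and \<gamma> :: real
  assumes B: "finite B" and V: "finite V" and p: "inj_on p B" "p ` B \<subseteq> V"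
    and \<gamma>: "\<gamma> \<ge> 0" "\<gamma> * card B \<le> 2 * s - DIM('a)"
  shows "(\<integral>\<^sup>+x. ennreal ((norm (LINT z|M. cis (\<Sum>e\<in>B. \<tau> e * (dist z (x (p e)))\<^sup>2)))\<^sup>2) \<partial>Pi\<^sub>M V (\<lambda>_. M))
    \<le> ennreal ((1 + osc_const) * (\<Prod>e\<in>B. max 1 \<bar>\<tau> e\<bar> powr - \<gamma>))"
proof -
  interpret P: product_sigma_finite "\<lambda>_::'v. M" by (rule product_sigma_finite_M)
  interpret PP: prob_space "Pi\<^sub>M W (\<lambda>_. M)" for W :: "'v set" by (intro prob_space_PiM prob)
  let ?F = "\<lambda>x. LINT z|M. cis (\<Sum>e\<in>B. \<tau> e * (dist z (x (p e)))\<^sup>2)"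
  have cm[measurable]: "(\<lambda>x. x (p e)) \<in> borel_measurable (Pi\<^sub>M V (\<lambda>_. M))" if "e \<in> B" for e
    using measurable_component_singleton[of "p e" V "\<lambda>_. M"] that p by (auto simp: measurable_cong_sets[OF refl sets_M])
  have Fm[measurable]: "?F \<in> borel_measurable (Pi\<^sub>M V (\<lambda>_. M))"
  proof (rule borel_measurable_lebesgue_integral)
    show "(\<lambda>(x, z). cis (\<Sum>e\<in>B. \<tau> e * (dist z (x (p e)))\<^sup>2)) \<in> borel_measurable (Pi\<^sub>M V (\<lambda>_. M) \<Otimes>\<^sub>M M)"
      unfolding split_beta' by measurable
  qed
  show ?thesis
  proof (cases "\<forall>e\<in>B. \<bar>\<tau> e\<bar> \<le> 1")
    case True
    \<comment> \<open>Low frequencies have no decay to prove: every factor is 1 and the trivial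
      bound by 1 is absorbed by the summand 1 in \<open>1 + osc_const\<close>.\<close>
    then have "(\<Prod>e\<in>B. max 1 \<bar>\<tau> e\<bar> powr - \<gamma>) = 1" by (intro prod.neutral) (auto simp: max_def)
    moreover have "norm (?F x) \<le> 1" for x
    proof -
      have "norm (?F x) \<le> (LINT z|M. 1)"
        by (rule order_trans[OF integral_norm_bound]) (simp add: prob_space)
      then show ?thesis by (simp add: prob_space)
    qed
    then have "(\<integral>\<^sup>+x. ennreal ((norm (?F x))\<^sup>2) \<partial>Pi\<^sub>M V (\<lambda>_. M)) \<le> (\<integral>\<^sup>+x. 1 \<partial>Pi\<^sub>M V (\<lambda>_. M))"
      by (intro nn_integral_mono) (simp add: power_le_one)
    moreover have "\<dots> \<le> ennreal (1 + osc_const)"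
      using osc_const_nonneg by (simp add: PP.emeasure_space_1)
    ultimately show ?thesis by simp
  next
    case False
    define m where "m = Max ((\<lambda>e. \<bar>\<tau> e\<bar>) ` B)"
    have "B \<noteq> {}" using False by auto
    then have "m \<in> (\<lambda>e. \<bar>\<tau> e\<bar>) ` B"
      unfolding m_def using B by (intro Max_in) auto
    then obtain e0 where e0: "e0 \<in> B" "\<bar>\<tau> e0\<bar> = m" by auto
    have le_m: "\<bar>\<tau> e\<bar> \<le> m" if "e \<in> B" for e using that B by (auto simp: m_def)
    have m1: "m > 1" using False le_m by force
    define W where "W = V - {p e0}"
    have VW: "V = insert (p e0) W" "p e0 \<notin> W" "finite W" using e0 p V by (auto simp: W_def)
    have bound: "(\<integral>\<^sup>+y. ennreal ((norm (?F (x(p e0 := y))))\<^sup>2) \<partial>M) \<le> ennreal (osc_const * m powr (DIM('a) - 2 * s))" for x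
    proof -
      \<comment> \<open>Everything that does not involve the averaged point \<open>y\<close>.
        Injectivity of \<open>p\<close> ensures that moving \<open>p e0\<close> leaves the other
        edges unchanged; the term \<open>|y|^2\<close> is a unimodular factor and vanishes in the
        norm.\<close>
      define \<theta> where "\<theta> z = \<tau> e0 * (norm z)\<^sup>2 + (\<Sum>e\<in>B - {e0}. \<tau> e * (dist z (x (p e)))\<^sup>2)" for z
      have \<theta>m: "\<theta> \<in> borel_measurable borel" unfolding \<theta>_def[abs_def] by measurable
      have "norm (?F (x(p e0 := y))) = norm (LINT z|M. cis (\<theta> z + 2 * (- \<tau> e0) * (z \<bullet> y)))" for y
      proof -
        have "(\<Sum>e\<in>B. \<tau> e * (dist z ((x(p e0 := y)) (p e)))\<^sup>2) = \<tau> e0 * (norm y)\<^sup>2 + (\<theta> z + 2 * (- \<tau> e0) * (z \<bullet> y))" for z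
        proof -
          have "(\<Sum>e\<in>B. \<tau> e * (dist z ((x(p e0 := y)) (p e)))\<^sup>2)
            = \<tau> e0 * (dist z y)\<^sup>2 + (\<Sum>e\<in>B - {e0}. \<tau> e * (dist z ((x(p e0 := y)) (p e)))\<^sup>2)"
            using B e0 by (simp add: sum.remove)
          also have "(\<Sum>e\<in>B - {e0}. \<tau> e * (dist z ((x(p e0 := y)) (p e)))\<^sup>2) = (\<Sum>e\<in>B - {e0}. \<tau> e * (dist z (x (p e)))\<^sup>2)"
            using p e0 by (intro sum.cong) (auto simp: inj_on_def)
          also have "(dist z y)\<^sup>2 = (norm z)\<^sup>2 - 2 * (z \<bullet> y) + (norm y)\<^sup>2"
            unfolding dist_norm power2_norm_eq_inner by (simp add: inner_diff_left inner_diff_right inner_commute)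
          finally show ?thesis by (simp add: \<theta>_def algebra_simps)
        qed
        then have "?F (x(p e0 := y)) = (LINT z|M. cis (\<tau> e0 * (norm y)\<^sup>2) * cis (\<theta> z + 2 * (- \<tau> e0) * (z \<bullet> y)))"
          by (simp only: cis_mult)
        also have "\<dots> = cis (\<tau> e0 * (norm y)\<^sup>2) * (LINT z|M. cis (\<theta> z + 2 * (- \<tau> e0) * (z \<bullet> y)))"
          by (rule integral_mult_right_zero)
        finally show ?thesis by (simp only: norm_mult norm_cis mult_1_left)
      qed
      then show ?thesis
        using oscillatory_square_estimate[OF \<theta>m, of "- \<tau> e0"] e0 m1 by simp
    qed
    have "(\<integral>\<^sup>+x. ennreal ((norm (?F x))\<^sup>2) \<partial>Pi\<^sub>M V (\<lambda>_. M))
      = (\<integral>\<^sup>+x. \<integral>\<^sup>+y. ennreal ((norm (?F (x(p e0 := y))))\<^sup>2) \<partial>M \<partial>Pi\<^sub>M W (\<lambda>_. M))"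
      unfolding VW(1) using VW(2,3) Fm[unfolded VW(1)] by (subst P.product_nn_integral_insert) simp_all
    also have "\<dots> \<le> (\<integral>\<^sup>+x. ennreal (osc_const * m powr (DIM('a) - 2 * s)) \<partial>Pi\<^sub>M W (\<lambda>_. M))"
      by (intro nn_integral_mono bound)
    also have "\<dots> = ennreal (osc_const * m powr (DIM('a) - 2 * s))"
      by (simp add: PP.emeasure_space_1)
    also have "\<dots> \<le> ennreal ((1 + osc_const) * (\<Prod>e\<in>B. max 1 \<bar>\<tau> e\<bar> powr - \<gamma>))"
    proof (intro ennreal_leI mult_mono)
      \<comment> \<open>The decay in the maximum is distributed equally over \<open>B\<close>;
        replacing \<open>m\<close> by a smaller frequency, cut off at 1, only enlarges a negative
        power.\<close>
      have "m powr (DIM('a) - 2 * s) \<le> m powr (- \<gamma> * card B)"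
        using \<gamma> m1 by (intro powr_mono) auto
      also have "\<dots> = (\<Prod>e\<in>B. m powr - \<gamma>)"
        using m1 by (simp add: powr_powr flip: powr_realpow)
      also have "\<dots> \<le> (\<Prod>e\<in>B. max 1 \<bar>\<tau> e\<bar> powr - \<gamma>)"
        using le_m m1 \<gamma> by (intro prod_mono) (auto intro!: powr_mono2')
      finally show "m powr (DIM('a) - 2 * s) \<le> (\<Prod>e\<in>B. max 1 \<bar>\<tau> e\<bar> powr - \<gamma>)" .
    qed (use osc_const_nonneg in auto)
    finally show ?thesis .
  qed
qed

end

section \<open>Integration over frequency space and the Gaussian filler\<close>

lemma nn_integral_max_powr_finite:
  fixes \<gamma> :: real assumes "\<gamma> > 1"
  shows "(\<integral>\<^sup>+t. ennreal (max 1 \<bar>t\<bar> powr - \<gamma>) \<partial>lborel) < \<infinity>"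
proof -
  let ?f = "\<lambda>t. ennreal (t powr - \<gamma>) * indicator {1..} t"
  have 1: "(\<integral>\<^sup>+t. ?f t \<partial>lborel) = ennreal (0 - 1 powr (1 - \<gamma>) / (1 - \<gamma>))"
  proof (rule nn_integral_FTC_atLeast[where F = "\<lambda>t. t powr (1 - \<gamma>) / (1 - \<gamma>)"])
    show "((\<lambda>t. t powr (1 - \<gamma>) / (1 - \<gamma>)) has_real_derivative t powr - \<gamma>) (at t)" if "1 \<le> t" for t
      using that assms by (auto intro!: derivative_eq_intros)
    have "((\<lambda>t::real. t powr (1 - \<gamma>)) \<longlongrightarrow> 0) at_top"
      using assms by (intro tendsto_neg_powr filterlim_ident) auto
    then show "((\<lambda>t. t powr (1 - \<gamma>) / (1 - \<gamma>)) \<longlongrightarrow> 0) at_top"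
      using tendsto_divide[OF _ tendsto_const[of "1 - \<gamma>"]] assms by fastforce
  qed auto
  have "(\<integral>\<^sup>+t. ?f (0 + (-1) * t) \<partial>lborel) = (\<integral>\<^sup>+t. ?f t \<partial>lborel)"
    using nn_integral_real_affine[of ?f "-1" 0] by simp
  then have 2: "(\<integral>\<^sup>+t. ?f (- t) \<partial>lborel) = (\<integral>\<^sup>+t. ?f t \<partial>lborel)" by simp
  have "(\<integral>\<^sup>+t. ennreal (max 1 \<bar>t\<bar> powr - \<gamma>) \<partial>lborel) \<le> (\<integral>\<^sup>+t. (indicator {-1..1} t + ?f t) + ?f (- t) \<partial>lborel)"
  proof (rule nn_integral_mono)
    fix t :: real
    consider "\<bar>t\<bar> \<le> 1" | "t > 1" | "t < - 1" by linarith
    then show "ennreal (max 1 \<bar>t\<bar> powr - \<gamma>) \<le> (indicator {-1..1} t + ?f t) + ?f (- t)"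
    proof cases
      case 1 then show ?thesis by (auto simp: indicator_def max_def abs_le_iff add_increasing2)
    qed (auto simp: indicator_def max_def)
  qed
  also have "\<dots> = (\<integral>\<^sup>+t. indicator {-1..1::real} t \<partial>lborel) + (\<integral>\<^sup>+t. ?f t \<partial>lborel) + (\<integral>\<^sup>+t. ?f (- t) \<partial>lborel)"
    by (subst nn_integral_add; simp)+
  also have "\<dots> < \<infinity>" unfolding 2 1 by (simp add: ennreal_add_less_top less_top[symmetric])
  finally show ?thesis .
qed

lemma nn_integral_prod_vec:
  fixes k :: "real \<Rightarrow> ennreal"
  assumes [measurable]: "k \<in> borel_measurable borel"
  shows "(\<integral>\<^sup>+\<tau>. (\<Prod>e\<in>UNIV. k ((\<tau> :: real^'e) $ e)) \<partial>lborel) = (\<integral>\<^sup>+t. k t \<partial>lborel) ^ CARD('e)"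
proof -
  have inj: "inj (\<lambda>e::'e. axis e (1::real))" by (auto simp: inj_def axis_eq_axis)
  have "(\<Prod>e\<in>UNIV. k (\<tau> $ e)) = (\<Prod>b\<in>Basis. k (\<tau> \<bullet> b))" for \<tau> :: "real^'e"
    unfolding Basis_vec_def using inj
    by (simp add: prod.reindex image_def[symmetric] inner_axis UNION_singleton_eq_range comp_def)
  then show ?thesis
    using nn_integral_lborel_prod[of "\<lambda>_::real^'e. k"] by simp
qed

lemma borel_measurable_vec_component [measurable]: "(\<lambda>x :: real^'e. x $ e) \<in> borel_measurable borel"
  by (intro borel_measurable_continuous_onI continuous_intros)

lemma borel_measurable_vecI:
  fixes f :: "'b \<Rightarrow> real^'e"
  assumes "\<And>e. (\<lambda>x. f x $ e) \<in> borel_measurable N"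
  shows "f \<in> borel_measurable N"
  using assms by (subst borel_measurable_euclidean_space) (auto simp: Basis_vec_def inner_axis)

text \<open>The filler is a probability measure, has the null sets of Lebesgue measure, and has a
  square-integrable characteristic function; all three properties are used.\<close>

definition gauss_measure :: "'a::euclidean_space measure" where
  "gauss_measure = density lborel (\<lambda>v. ennreal (gauss_density 1 v))"

lemma sets_gauss_measure [measurable_cong, simp]: "sets gauss_measure = sets borel"
  by (simp add: gauss_measure_def)

lemma space_gauss_measure [simp]: "space gauss_measure = UNIV"
  by (simp add: gauss_measure_def)

lemma prob_space_gauss_measure: "prob_space (gauss_measure :: 'a::euclidean_space measure)"
  using nn_integral_gauss_density[of 1 "0::'a"]
  by (intro prob_spaceI) (simp add: gauss_measure_def emeasure_density)

lemma AE_gauss_measure: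
  assumes "Measurable.pred borel P"
  shows "(AE v in gauss_measure. P v) \<longleftrightarrow> (AE v::'a::euclidean_space in lborel. P v)"
  unfolding gauss_measure_def by (subst AE_density) (auto simp: gauss_density_def)

lemma gauss_measure_char:
  "(LINT t|gauss_measure. cis (t \<bullet> (\<tau>::'a::euclidean_space))) = of_real (exp (- (norm \<tau>)\<^sup>2 / 4))"
proof -
  let ?n = "DIM('a)"
  have "(LINT t|gauss_measure. cis (t \<bullet> \<tau>)) = (LINT t|lborel. gauss_density 1 t *\<^sub>R cis (t \<bullet> \<tau>))"
    unfolding gauss_measure_def by (subst integral_density) (auto simp: gauss_density_nonneg)
  also have "\<dots> = (LINT t|lborel. of_real (sqrt (1 / pi) ^ ?n) * (of_real (exp (- 1 * (norm t)\<^sup>2)) * cis (\<tau> \<bullet> t)))"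
    by (intro Bochner_Integration.integral_cong) (auto simp: gauss_density_def scaleR_conv_of_real mult.assoc inner_commute)
  also have "\<dots> = of_real (sqrt (1 / pi) ^ ?n) * of_real (sqrt (pi / 1) ^ ?n * exp (- (norm \<tau>)\<^sup>2 / (4 * 1)))"
    unfolding integral_mult_right_zero using gaussian_fourier[of 1 \<tau>] by (simp add: has_bochner_integral_iff)
  also have "\<dots> = of_real ((sqrt (1 / pi) * sqrt pi) ^ ?n * exp (- (norm \<tau>)\<^sup>2 / 4))"
    by (simp add: power_mult_distrib)
  also have "sqrt (1 / pi) * sqrt pi = 1" by (simp flip: real_sqrt_mult)
  finally show ?thesis by simp
qed

context frostman_measure
begin

text \<open>The coordinates outside \<open>B\<close> are filled with an independent Gaussian, so that the law of the map can be
  absolutely continuous on the whole space.\<close>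

definition pinned_map :: "'e set \<Rightarrow> ('e::finite \<Rightarrow> 'v) \<Rightarrow> ('v \<Rightarrow> 'a) \<Rightarrow> 'a \<times> (real^'e) \<Rightarrow> real^'e" where
  "pinned_map B p x w = (\<chi> e. if e \<in> B then (dist (fst w) (x (p e)))\<^sup>2 else snd w $ e)"

lemma measurable_pinned_map [measurable]: "pinned_map B p x \<in> borel_measurable (M \<Otimes>\<^sub>M gauss_measure)"
  by (rule borel_measurable_vecI) (simp add: pinned_map_def)

text \<open>Tonelli turns the averaged bound into finiteness of the frequency integral for almost
  every \<open>x\<close>, so the L2 criterion applies to each such law. The quantifier over
  \<open>N\<close> stands inside the almost-everywhere statement because \<open>N\<close> will
  depend on \<open>x\<close>.\<close>

lemma pinned_law_null:
  fixes p :: "'e::finite \<Rightarrow> 'v"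
  assumes V: "finite V" and p: "inj_on p B" "p ` B \<subseteq> V"
    and s: "real (card B) + DIM('a) < 2 * s"
  shows "AE x in Pi\<^sub>M V (\<lambda>_. M). \<forall>N\<in>null_sets lborel.
    N \<in> null_sets (distr (M \<Otimes>\<^sub>M gauss_measure) borel (pinned_map B p x))"
proof -
  interpret G: prob_space "gauss_measure :: (real^'e) measure" by (rule prob_space_gauss_measure)
  interpret MG: pair_prob_space M "gauss_measure :: (real^'e) measure" by standard
  interpret PP: prob_space "Pi\<^sub>M V (\<lambda>_. M)" by (intro prob_space_PiM prob)
  interpret Q: pair_sigma_finite "Pi\<^sub>M V (\<lambda>_. M)" "lborel :: (real^'e) measure" by standard
  \<comment> \<open>The strict inequality on \<open>s\<close> is spent here: an exponent above 1 per
    edge makes each one-dimensional integral finite.\<close>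
  obtain \<gamma> :: real where \<gamma>: "\<gamma> > 1" "\<gamma> * card B \<le> 2 * s - DIM('a)"
  proof (cases "card B = 0")
    case True then show ?thesis using s that[of 2] by simp
  next
    case False
    then have "0 < real (card B)" by linarith
    then have "(2 * s - DIM('a)) / card B > 1" using s by (simp only: less_divide_eq_1_pos less_diff_eq)
    then show ?thesis by (rule that) (use False in simp)
  qed
  let ?F = "\<lambda>x \<tau>. LINT z|M. cis (\<Sum>e\<in>B. \<tau> $ e * (dist z (x (p e)))\<^sup>2)"
  \<comment> \<open>The frequencies seen by the filler. By independence the characteristic function
    is the pinned factor times a Gaussian in \<open>rest \<tau>\<close>.\<close>
  define rest where "rest = (\<lambda>\<tau>::real^'e. \<chi> e. if e \<in> B then 0 else \<tau> $ e)"
  let ?law = "\<lambda>x. distr (M \<Otimes>\<^sub>M gauss_measure) borel (pinned_map B p x)"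
  have char: "(LINT w|?law x. cis (w \<bullet> \<tau>)) = ?F x \<tau> * of_real (exp (- (norm (rest \<tau>))\<^sup>2 / 4))" for x \<tau>
  proof -
    have "pinned_map B p x w \<bullet> \<tau> = (\<Sum>e\<in>B. \<tau> $ e * (dist (fst w) (x (p e)))\<^sup>2) + snd w \<bullet> rest \<tau>" for w
    proof -
      have "pinned_map B p x w \<bullet> \<tau> = (\<Sum>e\<in>UNIV. (if e \<in> B then \<tau> $ e * (dist (fst w) (x (p e)))\<^sup>2 else 0) + snd w $ e * rest \<tau> $ e)"
        unfolding inner_vec_def by (intro sum.cong) (auto simp: pinned_map_def rest_def)
      also have "\<dots> = (\<Sum>e\<in>B. \<tau> $ e * (dist (fst w) (x (p e)))\<^sup>2) + snd w \<bullet> rest \<tau>"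
        unfolding sum.distrib inner_vec_def by (simp add: sum.If_cases)
      finally show ?thesis .
    qed
    then have "(LINT w|?law x. cis (w \<bullet> \<tau>)) = (LINT w|(M \<Otimes>\<^sub>M gauss_measure). cis (\<Sum>e\<in>B. \<tau> $ e * (dist (fst w) (x (p e)))\<^sup>2) * cis (snd w \<bullet> rest \<tau>))"
      by (subst integral_distr) (auto simp: cis_mult)
    also have "\<dots> = (LINT z|M. LINT t|gauss_measure. cis (\<Sum>e\<in>B. \<tau> $ e * (dist z (x (p e)))\<^sup>2) * cis (t \<bullet> rest \<tau>))"
    proof (subst MG.integral_fst'[symmetric])
      show "integrable (M \<Otimes>\<^sub>M gauss_measure) (\<lambda>w. cis (\<Sum>e\<in>B. \<tau> $ e * (dist (fst w) (x (p e)))\<^sup>2) * cis (snd w \<bullet> rest \<tau>))"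
        by (intro MG.integrable_const_bound[of _ 1]) (auto simp: norm_mult)
    qed simp
    also have "\<dots> = ?F x \<tau> * of_real (exp (- (norm (rest \<tau>))\<^sup>2 / 4))"
      by (simp only: integral_mult_right_zero integral_mult_left_zero gauss_measure_char)
    finally show ?thesis .
  qed
  have cm[measurable]: "(\<lambda>x. x (p e)) \<in> borel_measurable (Pi\<^sub>M V (\<lambda>_. M))" if "e \<in> B" for e
    using measurable_component_singleton[of "p e" V "\<lambda>_. M"] that p by (auto simp: measurable_cong_sets[OF refl sets_M])
  have rest_m[measurable]: "rest \<in> borel_measurable borel"
    by (rule borel_measurable_vecI) (simp add: rest_def)
  have Fm[measurable]: "(\<lambda>q. ?F (fst q) (snd q)) \<in> borel_measurable (Pi\<^sub>M V (\<lambda>_. M) \<Otimes>\<^sub>M lborel)"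
  proof (rule borel_measurable_lebesgue_integral)
    show "(\<lambda>(q, z). cis (\<Sum>e\<in>B. snd q $ e * (dist z (fst q (p e)))\<^sup>2)) \<in> borel_measurable ((Pi\<^sub>M V (\<lambda>_. M) \<Otimes>\<^sub>M lborel) \<Otimes>\<^sub>M M)"
      unfolding split_beta' by measurable
  qed
  \<comment> \<open>One majorant for both kinds of coordinates, the power for edges in
    \<open>B\<close> and the Gaussian for the others, so that the frequency integral becomes a power
    of a single one-dimensional integral.\<close>
  define k where "k t = max 1 \<bar>t\<bar> powr - \<gamma> + exp (- (1/2) * t\<^sup>2)" for t :: real
  have kfin: "(\<integral>\<^sup>+t. ennreal (k t) \<partial>lborel) < \<infinity>"
  proof -
    have "(\<integral>\<^sup>+t. ennreal (k t) \<partial>lborel) = (\<integral>\<^sup>+t. ennreal (max 1 \<bar>t\<bar> powr - \<gamma>) + ennreal (exp (- (1/2) * (norm (t - 0))\<^sup>2)) \<partial>lborel)"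
      by (intro nn_integral_cong) (simp add: k_def)
    also have "\<dots> = (\<integral>\<^sup>+t. ennreal (max 1 \<bar>t\<bar> powr - \<gamma>) \<partial>lborel) + (\<integral>\<^sup>+t. ennreal (exp (- (1/2) * (norm (t - 0))\<^sup>2)) \<partial>(lborel :: real measure))"
      by (rule nn_integral_add) measurable
    also have "\<dots> < \<infinity>"
      using nn_integral_max_powr_finite[OF \<gamma>(1)] by (subst nn_integral_gaussian) (auto simp: ennreal_add_less_top)
    finally show ?thesis .
  qed
  have km[measurable]: "k \<in> borel_measurable borel" unfolding k_def[abs_def] by measurable
  let ?S = "\<lambda>x \<tau>. ennreal ((norm (?F x \<tau>))\<^sup>2) * ennreal (exp (- (norm (rest \<tau>))\<^sup>2 / 2))"
  have le: "(\<integral>\<^sup>+x. ?S x \<tau> \<partial>Pi\<^sub>M V (\<lambda>_. M)) \<le> ennreal (1 + osc_const) * (\<Prod>e\<in>UNIV. ennreal (k (\<tau> $ e)))" for \<tau>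
  proof -
    have [measurable]: "(\<lambda>x. ?F x \<tau>) \<in> borel_measurable (Pi\<^sub>M V (\<lambda>_. M))"
      using measurable_compose[OF measurable_Pair2'[of \<tau> lborel] Fm] by simp
    have ex: "exp (- (norm (rest \<tau>))\<^sup>2 / 2) = (\<Prod>e\<in>-B. exp (- (1/2) * (\<tau> $ e)\<^sup>2))"
    proof -
      have "(norm (rest \<tau>))\<^sup>2 = (\<Sum>e\<in>UNIV. if e \<in> B then 0 else (\<tau> $ e)\<^sup>2)"
        unfolding power2_norm_eq_inner inner_vec_def by (intro sum.cong) (auto simp: rest_def power2_eq_square)
      also have "\<dots> = (\<Sum>e\<in>-B. (\<tau> $ e)\<^sup>2)" by (simp add: sum.If_cases)
      finally show ?thesis by (simp add: sum_divide_distrib sum_negf[symmetric] flip: exp_sum)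
    qed
    have "(\<integral>\<^sup>+x. ?S x \<tau> \<partial>Pi\<^sub>M V (\<lambda>_. M)) = (\<integral>\<^sup>+x. ennreal ((norm (?F x \<tau>))\<^sup>2) \<partial>Pi\<^sub>M V (\<lambda>_. M)) * ennreal (exp (- (norm (rest \<tau>))\<^sup>2 / 2))"
      by (rule nn_integral_multc) measurable
    also have "\<dots> \<le> ennreal ((1 + osc_const) * (\<Prod>e\<in>B. max 1 \<bar>\<tau> $ e\<bar> powr - \<gamma>)) * ennreal (exp (- (norm (rest \<tau>))\<^sup>2 / 2))"
      using \<gamma> by (intro mult_right_mono pinned_char_square_estimate V p) auto
    also have "ennreal ((1 + osc_const) * (\<Prod>e\<in>B. max 1 \<bar>\<tau> $ e\<bar> powr - \<gamma>)) * ennreal (exp (- (norm (rest \<tau>))\<^sup>2 / 2))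
      \<le> ennreal ((1 + osc_const) * (\<Prod>e\<in>UNIV. k (\<tau> $ e)))"
    proof -
      have "(\<Prod>e\<in>B. max 1 \<bar>\<tau> $ e\<bar> powr - \<gamma>) * (\<Prod>e\<in>-B. exp (- (1/2) * (\<tau> $ e)\<^sup>2)) \<le> (\<Prod>e\<in>B. k (\<tau> $ e)) * (\<Prod>e\<in>-B. k (\<tau> $ e))"
        by (intro mult_mono prod_mono prod_nonneg) (auto simp: k_def)
      also have "\<dots> = (\<Prod>e\<in>B \<union> - B. k (\<tau> $ e))" by (rule prod.union_disjoint[symmetric]) auto
      also have "B \<union> - B = UNIV" by auto
      finally have "(1 + osc_const) * ((\<Prod>e\<in>B. max 1 \<bar>\<tau> $ e\<bar> powr - \<gamma>) * (\<Prod>e\<in>-B. exp (- (1/2) * (\<tau> $ e)\<^sup>2))) \<le> (1 + osc_const) * (\<Prod>e\<in>UNIV. k (\<tau> $ e))"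
        using osc_const_nonneg by (intro mult_left_mono) auto
      then show ?thesis
        unfolding ex using osc_const_nonneg by (subst ennreal_mult[symmetric]) (auto intro!: ennreal_leI prod_nonneg mult_nonneg_nonneg simp: mult.assoc)
    qed
    also have "\<dots> = ennreal (1 + osc_const) * (\<Prod>e\<in>UNIV. ennreal (k (\<tau> $ e)))"
    proof -
      have k0: "k t \<ge> 0" for t by (simp add: k_def)
      have "(\<Prod>e\<in>UNIV. ennreal (k (\<tau> $ e))) = ennreal (\<Prod>e\<in>UNIV. k (\<tau> $ e))"
        by (rule prod_ennreal) (rule k0)
      then show ?thesis
        using osc_const_nonneg by (simp only:) (intro ennreal_mult prod_nonneg k0, simp)
    qed
    finally show ?thesis .
  qed
  have "(\<integral>\<^sup>+x. \<integral>\<^sup>+\<tau>. ?S x \<tau> \<partial>lborel \<partial>Pi\<^sub>M V (\<lambda>_. M)) = (\<integral>\<^sup>+\<tau>. \<integral>\<^sup>+x. ?S x \<tau> \<partial>Pi\<^sub>M V (\<lambda>_. M) \<partial>lborel)"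
    by (rule Q.Fubini'[symmetric]) (simp add: split_beta')
  also have "\<dots> \<le> (\<integral>\<^sup>+\<tau>. ennreal (1 + osc_const) * (\<Prod>e\<in>UNIV. ennreal (k ((\<tau> :: real^'e) $ e))) \<partial>lborel)"
    by (intro nn_integral_mono le)
  also have "\<dots> = ennreal (1 + osc_const) * (\<integral>\<^sup>+t. ennreal (k t) \<partial>lborel) ^ CARD('e)"
    by (subst nn_integral_prod_vec[symmetric]) (auto intro!: nn_integral_cmult)
  also have "\<dots> < \<infinity>" using kfin by (simp add: ennreal_mult_less_top power_less_top_ennreal)
  finally have fin: "(\<integral>\<^sup>+x. \<integral>\<^sup>+\<tau>. ?S x \<tau> \<partial>lborel \<partial>Pi\<^sub>M V (\<lambda>_. M)) \<noteq> \<infinity>" by auto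
  have "AE x in Pi\<^sub>M V (\<lambda>_. M). (\<integral>\<^sup>+\<tau>. ?S x \<tau> \<partial>lborel) \<noteq> \<infinity>"
  proof (rule nn_integral_PInf_AE[OF _ fin])
    have "(\<lambda>q. ?S (fst q) (snd q)) \<in> borel_measurable (Pi\<^sub>M V (\<lambda>_. M) \<Otimes>\<^sub>M lborel)" by measurable
    from lborel.borel_measurable_nn_integral_fst[OF this]
    show "(\<lambda>x. \<integral>\<^sup>+\<tau>. ?S x \<tau> \<partial>lborel) \<in> borel_measurable (Pi\<^sub>M V (\<lambda>_. M))" by simp
  qed
  then show ?thesis
  proof eventually_elim
    case (elim x)
    have "(\<integral>\<^sup>+\<tau>. ennreal ((norm (LINT w|?law x. cis (w \<bullet> \<tau>)))\<^sup>2) \<partial>lborel) = (\<integral>\<^sup>+\<tau>. ?S x \<tau> \<partial>lborel)"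
    proof (intro nn_integral_cong)
      fix \<tau> :: "real^'e"
      have "(exp (- (norm (rest \<tau>))\<^sup>2 / 4))\<^sup>2 = exp (- (norm (rest \<tau>))\<^sup>2 / 2)"
        by (simp add: power2_eq_square flip: exp_add)
      then show "ennreal ((norm (LINT w|?law x. cis (w \<bullet> \<tau>)))\<^sup>2) = ?S x \<tau>"
        unfolding char by (simp only: norm_mult norm_of_real abs_exp_cancel power_mult_distrib ennreal_mult zero_le_power2 exp_ge_zero)
    qed
    also have "\<dots> < \<infinity>" using elim by (simp add: less_top)
    finally have f: "(\<integral>\<^sup>+\<tau>. ennreal ((norm (LINT w|?law x. cis (w \<bullet> \<tau>)))\<^sup>2) \<partial>lborel) < \<infinity>" .
    show ?case
      using null_of_square_integrable_char[OF MG.prob_space_distr _ f] by simp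
  qed
qed

end

section \<open>Adding the vertices in a degeneracy order\<close>

text \<open>Squared distances turn the phase \<open>\<tau> * dist z y ^ 2\<close> into a function of \<open>z\<close>, a function of \<open>y\<close> and a
  bilinear term; \<open>t\<close> fills the coordinates of the edges that are not yet inside \<open>S\<close>.\<close>

definition distance_map :: "('e::finite \<Rightarrow> 'v \<times> 'v) \<Rightarrow> 'v set \<Rightarrow> ('v \<Rightarrow> 'a::metric_space) \<Rightarrow> real^'e \<Rightarrow> real^'e" where
  "distance_map ends S x t = (\<chi> e. if fst (ends e) \<in> S \<and> snd (ends e) \<in> S
      then (dist (x (fst (ends e))) (x (snd (ends e))))\<^sup>2 else t $ e)"

definition back_edges :: "('e \<Rightarrow> 'v \<times> 'v) \<Rightarrow> 'v set \<Rightarrow> 'v \<Rightarrow> 'e set" where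
  "back_edges ends S z = {e. (fst (ends e) = z \<and> snd (ends e) \<in> S) \<or> (snd (ends e) = z \<and> fst (ends e) \<in> S)}"

definition other_end :: "('e \<Rightarrow> 'v \<times> 'v) \<Rightarrow> 'v \<Rightarrow> 'e \<Rightarrow> 'v" where
  "other_end ends z e = (if fst (ends e) = z then snd (ends e) else fst (ends e))"

text \<open>The order on endpoints excludes loops and injectivity of \<open>ends\<close> excludes
  parallel edges, so edges from \<open>z\<close> into \<open>S\<close> correspond to distinct
  neighbours. Distinctness feeds the injectivity of \<open>p\<close> in
  \<open>pinned_law_null\<close>, the cardinality its exponent condition.\<close>

lemma back_edges_other_end:
  fixes ends :: "'e::finite \<Rightarrow> 'v::{finite,linorder} \<times> 'v"
  assumes g: "simple_graph ends" and z: "z \<notin> S"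
  shows inj_on_other_end: "inj_on (other_end ends z) (back_edges ends S z)"
    and other_end_in: "other_end ends z ` back_edges ends S z \<subseteq> S"
    and card_back_edges: "card (back_edges ends S z) \<le> card {u \<in> insert z S. adjacent ends u z}"
proof -
  have lt: "fst (ends e) < snd (ends e)" for e using g by (simp add: simple_graph_def)
  have ij: "ends e = ends e' \<Longrightarrow> e = e'" for e e' using g by (auto simp: simple_graph_def inj_def)
  have cases: "ends e = (z, other_end ends z e) \<and> z < other_end ends z e \<or> ends e = (other_end ends z e, z) \<and> other_end ends z e < z"
    if "e \<in> back_edges ends S z" for e
    using that lt[of e] z by (cases "ends e") (auto simp: back_edges_def other_end_def)
  show inj: "inj_on (other_end ends z) (back_edges ends S z)"
  proof (rule inj_onI)
    fix e e' assume "e \<in> back_edges ends S z" "e' \<in> back_edges ends S z" "other_end ends z e = other_end ends z e'"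
    then have "ends e = ends e'" using cases[of e] cases[of e'] by auto
    then show "e = e'" by (rule ij)
  qed
  show sub: "other_end ends z ` back_edges ends S z \<subseteq> S"
    using z by (auto simp: back_edges_def other_end_def)
  have "card (back_edges ends S z) = card (other_end ends z ` back_edges ends S z)"
    using inj by (simp add: card_image)
  also have "\<dots> \<le> card {u \<in> insert z S. adjacent ends u z}"
  proof (rule card_mono)
    show "other_end ends z ` back_edges ends S z \<subseteq> {u \<in> insert z S. adjacent ends u z}"
    proof
      fix u assume "u \<in> other_end ends z ` back_edges ends S z"
      then obtain e where e: "e \<in> back_edges ends S z" "u = other_end ends z e" by auto
      then have "adjacent ends u z" using cases[OF e(1)] unfolding adjacent_def by auto
      then show "u \<in> {u \<in> insert z S. adjacent ends u z}" using sub e by auto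
    qed
  qed simp
  finally show "card (back_edges ends S z) \<le> card {u \<in> insert z S. adjacent ends u z}" .
qed

context frostman_measure
begin

lemma measurable_distance_map:
  fixes ends :: "'e::finite \<Rightarrow> 'v \<times> 'v"
  shows "(\<lambda>q. distance_map ends S (fst q) (snd q)) \<in> borel_measurable (Pi\<^sub>M S (\<lambda>_. M) \<Otimes>\<^sub>M gauss_measure)"
proof (rule borel_measurable_vecI)
  fix e
  have cm: "(\<lambda>x. x v) \<in> borel_measurable (Pi\<^sub>M S (\<lambda>_. M))" if "v \<in> S" for v
    using measurable_component_singleton[of v S "\<lambda>_. M"] that by (auto simp: measurable_cong_sets[OF refl sets_M])
  show "(\<lambda>q. distance_map ends S (fst q) (snd q) $ e) \<in> borel_measurable (Pi\<^sub>M S (\<lambda>_. M) \<Otimes>\<^sub>M gauss_measure)"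
  proof (cases "fst (ends e) \<in> S \<and> snd (ends e) \<in> S")
    case True
    then have [measurable]: "(\<lambda>x. x (fst (ends e))) \<in> borel_measurable (Pi\<^sub>M S (\<lambda>_. M))" "(\<lambda>x. x (snd (ends e))) \<in> borel_measurable (Pi\<^sub>M S (\<lambda>_. M))"
      using cm by auto
    show ?thesis unfolding distance_map_def using True by simp
  next
    case False
    then have "(\<lambda>q :: ('v \<Rightarrow> 'a) \<times> (real^'e). distance_map ends S (fst q) (snd q) $ e) = (\<lambda>q. snd q $ e)"
      by (auto simp: distance_map_def)
    then show ?thesis by simp
  qed
qed

text \<open>No elimination order is built: at each stage the degeneracy bound names a vertex of
  \<open>S\<close> with few neighbours in \<open>S\<close>, which is treated as the last one.
  Revealing it only replaces the Gaussian argument of the smaller distance map by a pinned vector,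
  whose law ignores null sets.\<close>

lemma distance_map_null:
  fixes ends :: "'e::finite \<Rightarrow> 'v::{finite,linorder} \<times> 'v"
  assumes g: "simple_graph ends" and k: "degeneracy_bound ends k" and s: "real k + DIM('a) < 2 * s"
    and Z: "Z \<in> null_sets (lborel :: (real^'e) measure)"
  shows "(\<integral>\<^sup>+x. \<integral>\<^sup>+t. indicator Z (distance_map ends S x t) \<partial>gauss_measure \<partial>Pi\<^sub>M S (\<lambda>_. M)) = 0"
proof (induction "card S" arbitrary: S)
  interpret G: prob_space "gauss_measure :: (real^'e) measure" by (rule prob_space_gauss_measure)
  interpret MG: pair_prob_space M "gauss_measure :: (real^'e) measure" by standard
  have Zs[measurable]: "Z \<in> sets borel" using Z by auto
  have gnull: "emeasure gauss_measure A = 0 \<longleftrightarrow> emeasure lborel A = 0" if [measurable]: "A \<in> sets borel" for A :: "(real^'e) set"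
    using AE_gauss_measure[of "\<lambda>x. x \<notin> A"] that by (simp add: AE_iff_measurable[OF _ refl])
  {
    case 0
    then have "S = {}" by simp
    \<comment> \<open>With no vertices every coordinate is filler, so the distance map is the
      identity in \<open>t\<close>.\<close>
    have "emeasure gauss_measure Z = 0" using gnull[OF Zs] Z by auto
    then show ?case unfolding \<open>S = {}\<close>
      by (simp add: distance_map_def PiM_empty nn_integral_count_space_finite)
  next
    case (Suc n)
    interpret P: product_sigma_finite "\<lambda>_::'v. M" by (rule product_sigma_finite_M)
    have "S \<noteq> {}" using Suc(2) by auto
    then obtain z where z: "z \<in> S" "card {u \<in> S. adjacent ends u z} \<le> k"
      using k unfolding degeneracy_bound_def by blast
    define T where "T = S - {z}"
    have T: "S = insert z T" "z \<notin> T" "n = card T" "finite T" using z Suc(2) by (auto simp: T_def)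
    let ?B = "back_edges ends T z" and ?p = "other_end ends z"
    have "real (card ?B) + DIM('a) < 2 * s"
      using card_back_edges[OF g T(2)] z(2) s unfolding T(1) by linarith
    note law = pinned_law_null[OF T(4) inj_on_other_end[OF g T(2)] other_end_in[OF g T(2)] this]
    \<comment> \<open>Edges inside \<open>T\<close> are overwritten by the outer map, edges from
      \<open>z\<close> to \<open>T\<close> are supplied by \<open>pinned_map\<close>, and all other
      coordinates pass \<open>t\<close> through.\<close>
    have split: "distance_map ends S (x(z := y)) t = distance_map ends T x (pinned_map ?B ?p x (y, t))" for x y t
    proof -
      have "distance_map ends S (x(z := y)) t $ e = distance_map ends T x (pinned_map ?B ?p x (y, t)) $ e" for e
      proof -
        have "fst (ends e) < snd (ends e)" using g by (simp add: simple_graph_def)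
        then show ?thesis
          using T(2) by (auto simp: T(1) distance_map_def pinned_map_def back_edges_def other_end_def dist_commute)
      qed
      then show ?thesis by (simp add: vec_eq_iff)
    qed
    have m1: "(\<lambda>x. \<integral>\<^sup>+t. indicator Z (distance_map ends W x t) \<partial>gauss_measure) \<in> borel_measurable (Pi\<^sub>M W (\<lambda>_. M))" for W
    proof -
      have "(\<lambda>q. indicator Z (distance_map ends W (fst q) (snd q)) :: ennreal) \<in> borel_measurable (Pi\<^sub>M W (\<lambda>_. M) \<Otimes>\<^sub>M gauss_measure)"
        by (rule measurable_compose[OF measurable_distance_map]) measurable
      from G.borel_measurable_nn_integral_fst[OF this] show ?thesis by simp
    qed
    have "(\<integral>\<^sup>+x. \<integral>\<^sup>+t. indicator Z (distance_map ends S x t) \<partial>gauss_measure \<partial>Pi\<^sub>M S (\<lambda>_. M))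
      = (\<integral>\<^sup>+x. \<integral>\<^sup>+y. \<integral>\<^sup>+t. indicator Z (distance_map ends S (x(z := y)) t) \<partial>gauss_measure \<partial>M \<partial>Pi\<^sub>M T (\<lambda>_. M))"
      using m1[of S] T unfolding T(1) by (subst P.product_nn_integral_insert) auto
    also have "\<dots> = (\<integral>\<^sup>+x. 0 \<partial>Pi\<^sub>M T (\<lambda>_. M))"
    proof (rule nn_integral_cong_AE)
      have "AE x in Pi\<^sub>M T (\<lambda>_. M). (\<integral>\<^sup>+t. indicator Z (distance_map ends T x t) \<partial>gauss_measure) = 0"
        using Suc(1)[OF T(3)] m1[of T] by (simp add: nn_integral_0_iff_AE)
      with law AE_space[of "Pi\<^sub>M T (\<lambda>_. M)"]
      show "AE x in Pi\<^sub>M T (\<lambda>_. M). (\<integral>\<^sup>+y. \<integral>\<^sup>+t. indicator Z (distance_map ends S (x(z := y)) t) \<partial>gauss_measure \<partial>M) = 0"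
      proof eventually_elim
        case (elim x)
        let ?law = "distr (M \<Otimes>\<^sub>M gauss_measure) borel (pinned_map ?B ?p x)"
        \<comment> \<open>The bad filler values for the fixed earlier points \<open>x\<close>. The
          induction hypothesis makes this set null for almost every \<open>x\<close>.\<close>
        define N where "N = {t. distance_map ends T x t \<in> Z}"
        have dm[measurable]: "distance_map ends T x \<in> borel_measurable borel"
          using measurable_compose[OF measurable_Pair1'[OF elim(2)] measurable_distance_map[of ends T]]
          by (simp add: measurable_cong_sets[OF sets_gauss_measure refl])
        have Ns[measurable]: "N \<in> sets borel"
          using measurable_sets[OF dm Zs] by (simp add: N_def vimage_def)
        have ind: "indicator Z (distance_map ends T x t) = (indicator N t :: ennreal)" for t
          by (simp add: N_def indicator_def)
        have "emeasure gauss_measure N = 0"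
          using elim(3) unfolding ind by simp
        then have "N \<in> null_sets lborel" using gnull[OF Ns] Ns by auto
        then have "N \<in> null_sets ?law" using elim(1) by blast
        then have "0 = (\<integral>\<^sup>+w. indicator N w \<partial>?law)" by auto
        also have "\<dots> = (\<integral>\<^sup>+q. indicator N (pinned_map ?B ?p x q) \<partial>(M \<Otimes>\<^sub>M gauss_measure))"
          by (rule nn_integral_distr) measurable
        also have "\<dots> = (\<integral>\<^sup>+y. \<integral>\<^sup>+t. indicator N (pinned_map ?B ?p x (y, t)) \<partial>gauss_measure \<partial>M)"
          by (rule G.nn_integral_fst[symmetric]) measurable
        finally show ?case unfolding split ind by simp
      qed
    qed
    finally show ?case by simp
  }
qed

end

section \<open>Frostman's lemma\<close>

lemma hausdorff_content_le_diameter: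
  assumes s: "s > 0" and \<delta>: "\<delta> \<ge> 0" and A: "bounded A" "diameter A \<le> \<delta>"
  shows "hausdorff_content s \<delta> A \<le> ennreal (diameter A powr s)"
proof -
  define U where "U i = (if i = 0 then A else {})" for i :: nat
  have "hausdorff_content s \<delta> A \<le> (\<Sum>i. ennreal (diameter (U i) powr s))"
    unfolding hausdorff_content_def using A \<delta> by (intro INF_lower) (auto simp: U_def)
  also have "\<dots> = (\<Sum>i\<in>{0}. ennreal (diameter (U i) powr s))"
    by (rule suminf_finite) (auto simp: U_def)
  finally show ?thesis by (simp add: U_def)
qed

text \<open>Near-optimal covers of the two sets are interleaved by the parity of the index.\<close>

lemma hausdorff_content_Un:
  "hausdorff_content s \<delta> (A \<union> B) \<le> hausdorff_content s \<delta> A + hausdorff_content s \<delta> B"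
proof -
  let ?S = "\<lambda>A::'a set. {U :: nat \<Rightarrow> 'a set. A \<subseteq> (\<Union>i. U i) \<and> (\<forall>i. bounded (U i) \<and> diameter (U i) \<le> \<delta>)}"
  let ?f = "\<lambda>U :: nat \<Rightarrow> 'a set. \<Sum>i. ennreal (diameter (U i) powr s)"
  have *: "hausdorff_content s \<delta> (A \<union> B) \<le> ?f U + ?f V" if U: "U \<in> ?S A" and V: "V \<in> ?S B" for U V
  proof -
    define W where "W i = (if even i then U (i div 2) else V (i div 2))" for i
    have WU: "W (2 * i) = U i" and WV: "W (2 * i + 1) = V i" for i by (auto simp: W_def)
    have "A \<union> B \<subseteq> (\<Union>i. W i)"
      using U V WU WV by (auto simp: subset_iff) (metis, metis)
    then have "W \<in> ?S (A \<union> B)" using U V by (auto simp: W_def)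
    then have "hausdorff_content s \<delta> (A \<union> B) \<le> ?f W"
      unfolding hausdorff_content_def by (rule INF_lower)
    also have "\<dots> \<le> ?f U + ?f V"
    proof (rule suminf_le_const)
      fix n
      let ?w = "\<lambda>i. ennreal (diameter (W i) powr s)"
      have "(\<Sum>i<n. ?w i) \<le> (\<Sum>i<2 * n. ?w i)" by (intro sum_mono2) auto
      also have "\<dots> = (\<Sum>i<n. ennreal (diameter (U i) powr s)) + (\<Sum>i<n. ennreal (diameter (V i) powr s))"
        by (induction n) (use WU WV in \<open>auto simp: ac_simps\<close>)
      also have "\<dots> \<le> ?f U + ?f V"
        by (intro add_mono sum_le_suminf) auto
      finally show "(\<Sum>i<n. ?w i) \<le> ?f U + ?f V" .
    qed simp
    finally show ?thesis .
  qed
  have cover: "\<exists>U\<in>?S A. ?f U \<le> hausdorff_content s \<delta> A + ennreal e"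
    if "hausdorff_content s \<delta> A < top" "e > 0" for A e
  proof -
    have "hausdorff_content s \<delta> A < hausdorff_content s \<delta> A + ennreal e"
      using that by (cases "hausdorff_content s \<delta> A") (auto simp: ennreal_less_iff simp flip: ennreal_plus)
    then show ?thesis
      unfolding hausdorff_content_def[of s \<delta> A] INF_less_iff by (auto intro: less_imp_le)
  qed
  show ?thesis
  proof (rule ennreal_le_epsilon)
    fix e :: real
    assume fin: "hausdorff_content s \<delta> A + hausdorff_content s \<delta> B < top" and e: "0 < e"
    from fin have fA: "hausdorff_content s \<delta> A < top" and fB: "hausdorff_content s \<delta> B < top" by auto
    from cover[OF fA half_gt_zero[OF e]] obtain U
      where U: "U \<in> ?S A" "?f U \<le> hausdorff_content s \<delta> A + ennreal (e / 2)" by (rule bexE)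
    from cover[OF fB half_gt_zero[OF e]] obtain V
      where V: "V \<in> ?S B" "?f V \<le> hausdorff_content s \<delta> B + ennreal (e / 2)" by (rule bexE)
    have "hausdorff_content s \<delta> (A \<union> B) \<le> ?f U + ?f V" by (rule *[OF U(1) V(1)])
    also have "\<dots> \<le> (hausdorff_content s \<delta> A + ennreal (e / 2)) + (hausdorff_content s \<delta> B + ennreal (e / 2))"
      by (intro add_mono U V)
    also have "\<dots> = hausdorff_content s \<delta> A + hausdorff_content s \<delta> B + (ennreal (e / 2) + ennreal (e / 2))"
      by (simp only: ac_simps)
    also have "ennreal (e / 2) + ennreal (e / 2) = ennreal e"
      using e by (simp flip: ennreal_plus)
    finally show "hausdorff_content s \<delta> (A \<union> B) \<le> hausdorff_content s \<delta> A + hausdorff_content s \<delta> B + ennreal e" .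
  qed
qed

section \<open>Random branches through a tree of cells\<close>

lemma subadditive_UN:
  fixes c :: "'a set \<Rightarrow> real"
  assumes "c {} = 0" and "\<And>A B. c (A \<union> B) \<le> c A + c B" and "finite I"
  shows "c (\<Union>i\<in>I. A i) \<le> (\<Sum>i\<in>I. c (A i))"
  using assms(3) by (induction I) (auto simp: assms(1) intro: order_trans[OF assms(2)])

text \<open>The Frostman measure will be the law of the limit of a random branch, so no weak limit
  of measures is taken. If a cell passes to its children in proportion to their content,
  subadditivity makes each transition probability at most the child's content over the parent's.
  Along a branch these ratios telescope.\<close>

locale mass_tree =
  fixes lab :: "nat \<Rightarrow> 'a \<Rightarrow> 'l::countable" and par :: "'l \<Rightarrow> 'l" and E :: "'a set"
    and c :: "'a set \<Rightarrow> real" and root :: 'l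
  assumes par_lab: "\<And>n x. par (lab (Suc n) x) = lab n x"
    and finite_labels: "\<And>n. finite (lab n ` E)"
    and c_nonneg: "\<And>A. c A \<ge> 0" and c_empty: "c {} = 0"
    and c_Un: "\<And>A B. c (A \<union> B) \<le> c A + c B"
    and root_pos: "c {x \<in> E. lab 0 x = root} > 0"
begin

definition cell :: "nat \<Rightarrow> 'l \<Rightarrow> 'a set" where
  "cell n l = {x \<in> E. lab n x = l}"

text \<open>Nothing is demanded at a cell of content 0, so a law exists at every pair of level and
  label. The support condition keeps the branch in cells of positive content, which are therefore
  nonempty.\<close>

definition step_law :: "nat \<Rightarrow> 'l \<Rightarrow> 'l pmf \<Rightarrow> bool" where
  "step_law n l p \<longleftrightarrow> (c (cell n l) > 0 \<longrightarrow>
     (\<forall>l'. pmf p l' * c (cell n l) \<le> c (cell (Suc n) l')) \<and>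
     set_pmf p \<subseteq> {l'. par l' = l \<and> c (cell (Suc n) l') > 0})"

lemma ex_step_law: "\<exists>p. step_law n l p"
proof (cases "c (cell n l) > 0")
  case True
  define I where "I = {l' \<in> lab (Suc n) ` E. par l' = l}"
  have I: "finite I" using finite_labels[of "Suc n"] by (simp add: I_def)
  define T where "T = (\<Sum>l'\<in>I. c (cell (Suc n) l'))"
  have "cell n l = (\<Union>l'\<in>I. cell (Suc n) l')"
    by (auto simp: cell_def I_def par_lab) (metis par_lab)
  then have T: "c (cell n l) \<le> T" unfolding T_def
    using subadditive_UN[of c, OF c_empty c_Un I] by simp
  then have T0: "T > 0" using True by simp
  \<comment> \<open>The denominator is the children's total \<open>T\<close>, at least the parent's
    content, so this is a probability and still satisfies the ratio bound.\<close>
  define f where "f l' = (if l' \<in> I then c (cell (Suc n) l') / T else 0)" for l'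
  have f0: "f l' \<ge> 0" for l' using T0 c_nonneg by (simp add: f_def)
  have "(\<integral>\<^sup>+l'. ennreal (f l') \<partial>count_space UNIV) = (\<Sum>l'\<in>I. ennreal (f l'))"
    by (rule nn_integral_count_space'[OF I]) (auto simp: f_def)
  also have "\<dots> = ennreal (\<Sum>l'\<in>I. f l')" using f0 by (intro sum_ennreal) auto
  also have "(\<Sum>l'\<in>I. f l') = T / T" by (simp add: f_def T_def[symmetric] sum_divide_distrib[symmetric])
  finally have f1: "(\<integral>\<^sup>+l'. ennreal (f l') \<partial>count_space UNIV) = 1" using T0 by simp
  have "pmf (embed_pmf f) l' * c (cell n l) \<le> c (cell (Suc n) l')" for l'
  proof (cases "l' \<in> I")
    case True
    have "c (cell (Suc n) l') / T * c (cell n l) \<le> c (cell (Suc n) l') / T * T"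
      using T T0 c_nonneg by (intro mult_left_mono) auto
    then show ?thesis using True T0 by (simp add: pmf_embed_pmf[OF f0 f1] f_def)
  qed (simp add: pmf_embed_pmf[OF f0 f1] f_def c_nonneg)
  moreover have "set_pmf (embed_pmf f) \<subseteq> {l'. par l' = l \<and> c (cell (Suc n) l') > 0}"
    using c_nonneg by (auto simp: set_embed_pmf[OF f0 f1] f_def I_def order_less_le split: if_splits)
  ultimately show ?thesis unfolding step_law_def by blast
qed (auto simp: step_law_def)

definition step_pmf :: "nat \<times> 'l \<Rightarrow> 'l pmf" where
  "step_pmf q = (SOME p. step_law (fst q) (snd q) p)"

lemma step_law_step_pmf: "step_law n l (step_pmf (n, l))"
  unfolding step_pmf_def using someI_ex[OF ex_step_law] by simp

text \<open>Each node independently chooses a child; the random branch follows the choices from the root.\<close>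

definition choice_measure :: "(nat \<times> 'l \<Rightarrow> 'l) measure" where
  "choice_measure = Pi\<^sub>M UNIV (\<lambda>q. measure_pmf (step_pmf q))"

primrec branch :: "(nat \<times> 'l \<Rightarrow> 'l) \<Rightarrow> nat \<Rightarrow> 'l" where
  "branch \<omega> 0 = root"
| "branch \<omega> (Suc n) = \<omega> (n, branch \<omega> n)"

sublocale choice: product_prob_space "\<lambda>q. measure_pmf (step_pmf q)" UNIV
  by (intro product_prob_spaceI prob_space_measure_pmf)

lemma prob_space_choice_measure: "prob_space choice_measure"
  unfolding choice_measure_def by (intro prob_space_PiM prob_space_measure_pmf)

lemma space_choice_measure: "space choice_measure = UNIV"
  by (simp add: choice_measure_def space_PiM)

lemma measurable_choice: "(\<lambda>\<omega>. \<omega> q) \<in> measurable choice_measure (count_space UNIV)"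
  unfolding choice_measure_def using measurable_component_singleton[of q UNIV "\<lambda>q. measure_pmf (step_pmf q)"] by simp

lemma measurable_branch [measurable]: "(\<lambda>\<omega>. branch \<omega> n) \<in> measurable choice_measure (count_space UNIV)"
proof (induction n)
  case (Suc n)
  show ?case unfolding branch.simps
    by (rule measurable_compose_countable[OF measurable_choice Suc])
qed simp

lemma AE_branch:
  "AE \<omega> in choice_measure. \<forall>n. c (cell n (branch \<omega> n)) > 0 \<and> par (branch \<omega> (Suc n)) = branch \<omega> n"
proof -
  have "AE \<omega> in choice_measure. \<forall>q. \<omega> q \<in> set_pmf (step_pmf q)"
    unfolding AE_all_countable choice_measure_def
    by (intro allI choice.AE_component AE_measure_pmf) auto
  then show ?thesis
  proof eventually_elim
    case (elim \<omega>)
    have step: "par (branch \<omega> (Suc n)) = branch \<omega> n \<and> c (cell (Suc n) (branch \<omega> (Suc n))) > 0"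
      if "c (cell n (branch \<omega> n)) > 0" for n
      using step_law_step_pmf[of n "branch \<omega> n"] that elim unfolding step_law_def by auto
    have "c (cell n (branch \<omega> n)) > 0" for n
      by (induction n) (use root_pos step in \<open>auto simp: cell_def\<close>)
    then show ?case using step by blast
  qed
qed

text \<open>Almost surely a branch can reach \<open>l\<close> only through the ancestors of
  \<open>l\<close>. The choices at these ancestors are independent, and the product of the ratio
  bounds telescopes to the content of \<open>l\<close> over that of the root.\<close>

lemma emeasure_branch_le:
  "emeasure choice_measure {\<omega>. branch \<omega> n = l} \<le> ennreal (c (cell n l) / c (cell 0 root))"
proof -
  let ?c0 = "c (cell 0 root)"
  have c0: "?c0 > 0" using root_pos by (simp add: cell_def)
  define a where "a i = (par ^^ (n - i)) l" for i
  show ?thesis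
  proof (cases "a 0 = root")
    case False
    have "AE \<omega> in choice_measure. \<omega> \<notin> {\<omega>. branch \<omega> n = l}"
      using AE_branch
    proof eventually_elim
      case (elim \<omega>)
      have "branch \<omega> 0 = (par ^^ k) (branch \<omega> k)" for k
      proof (induction k)
        case (Suc k)
        have "(par ^^ Suc k) (branch \<omega> (Suc k)) = (par ^^ k) (branch \<omega> k)"
          unfolding funpow_Suc_right using elim by simp
        then show ?case using Suc by simp
      qed simp
      from this[of n] show ?case using False by (auto simp: a_def)
    qed
    moreover have "{\<omega>. branch \<omega> n = l} \<in> sets choice_measure"
      using measurable_sets[OF measurable_branch[of n], of "{l}"] by (simp add: space_choice_measure vimage_def)
    ultimately have "emeasure choice_measure {\<omega>. branch \<omega> n = l} = 0"
      by (simp add: AE_iff_measurable[OF _ refl] space_choice_measure)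
    then show ?thesis by simp
  next
    case True
    \<comment> \<open>The level is part of the index: ancestors at different levels may carry the
      same label but must be different independent choices.\<close>
    define J where "J = (\<lambda>i. (i, a i)) ` {..<n}"
    define X where "X q = {a (Suc (fst q))}" for q :: "nat \<times> 'l"
    have Cs: "{\<omega>. \<forall>q\<in>J. \<omega> q \<in> X q} \<in> sets choice_measure"
    proof -
      have "{\<omega> \<in> space choice_measure. \<forall>q\<in>J. \<omega> q \<in> X q} \<in> sets choice_measure"
      proof (rule sets.sets_Collect_finite_All)
        fix q
        show "{\<omega> \<in> space choice_measure. \<omega> q \<in> X q} \<in> sets choice_measure"
          using measurable_sets[OF measurable_choice[of q], of "X q"] by (simp add: vimage_def Int_def conj_commute)
      qed (simp add: J_def)
      then show ?thesis by (simp add: space_choice_measure)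
    qed
    have "emeasure choice_measure {\<omega>. branch \<omega> n = l} \<le> emeasure choice_measure {\<omega>. \<forall>q\<in>J. \<omega> q \<in> X q}"
    proof (rule emeasure_mono_AE[OF _ Cs])
      show "AE \<omega> in choice_measure. \<omega> \<in> {\<omega>. branch \<omega> n = l} \<longrightarrow> \<omega> \<in> {\<omega>. \<forall>q\<in>J. \<omega> q \<in> X q}"
        using AE_branch
      proof eventually_elim
        case (elim \<omega>)
        show ?case
        proof (intro impI)
          assume "\<omega> \<in> {\<omega>. branch \<omega> n = l}"
          then have l: "branch \<omega> n = l" by simp
          have ba: "branch \<omega> (n - k) = a (n - k)" if "k \<le> n" for k
            using that
          proof (induction k)
            case (Suc k)
            have e: "n - k = Suc (n - Suc k)" using Suc.prems by simp
            have "branch \<omega> (n - Suc k) = par (branch \<omega> (n - k))" using elim unfolding e by simp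
            also have "\<dots> = par (a (n - k))" using Suc by simp
            also have "\<dots> = a (n - Suc k)" using Suc.prems by (simp add: a_def)
            finally show ?case .
          qed (simp add: l a_def)
          have ba: "branch \<omega> i = a i" if "i \<le> n" for i using ba[of "n - i"] that by simp
          have "\<omega> (i, a i) = a (Suc i)" if "i < n" for i
            using ba[of i] ba[of "Suc i"] that by simp
          then show "\<omega> \<in> {\<omega>. \<forall>q\<in>J. \<omega> q \<in> X q}" by (auto simp: J_def X_def)
        qed
      qed
    qed
    also have "emeasure choice_measure {\<omega>. \<forall>q\<in>J. \<omega> q \<in> X q} = (\<Prod>q\<in>J. emeasure (measure_pmf (step_pmf q)) (X q))"
      using choice.emeasure_PiM_Collect[of J X] by (simp add: J_def choice_measure_def space_PiM)
    also have "\<dots> = (\<Prod>i<n. emeasure (measure_pmf (step_pmf (i, a i))) {a (Suc i)})"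
      unfolding J_def by (subst prod.reindex) (auto simp: inj_on_def X_def)
    also have "\<dots> = ennreal (\<Prod>i<n. pmf (step_pmf (i, a i)) (a (Suc i)))"
      by (simp add: emeasure_pmf_single prod_ennreal)
    also have "\<dots> \<le> ennreal (c (cell n l) / ?c0)"
    proof (rule ennreal_leI)
      have "(\<Prod>i<m. pmf (step_pmf (i, a i)) (a (Suc i))) \<le> c (cell m (a m)) / ?c0" for m
      proof (induction m)
        case 0
        then show ?case using True c0 by simp
      next
        case (Suc m)
        let ?p = "pmf (step_pmf (m, a m)) (a (Suc m))"
        have "(\<Prod>i<Suc m. pmf (step_pmf (i, a i)) (a (Suc i))) \<le> c (cell m (a m)) / ?c0 * ?p"
          unfolding prod.lessThan_Suc by (rule mult_right_mono[OF Suc pmf_nonneg])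
        also have "\<dots> \<le> c (cell (Suc m) (a (Suc m))) / ?c0"
        proof (cases "c (cell m (a m)) > 0")
          case True
          then have "?p * c (cell m (a m)) \<le> c (cell (Suc m) (a (Suc m)))"
            using step_law_step_pmf[of m "a m"] unfolding step_law_def by blast
          then show ?thesis using c0 by (simp add: divide_right_mono mult.commute)
        next
          case False
          then have "c (cell m (a m)) = 0" using c_nonneg[of "cell m (a m)"] by simp
          then show ?thesis using c0 c_nonneg by simp
        qed
        finally show ?case .
      qed
      from this[of n] show "(\<Prod>i<n. pmf (step_pmf (i, a i)) (a (Suc i))) \<le> c (cell n l) / ?c0"
        by (simp add: a_def)
    qed
    finally show ?thesis .
  qed
qed

end

section \<open>Dyadic cubes and truncated Hausdorff content\<close>

definition dyadic_label :: "nat \<Rightarrow> real^'d \<Rightarrow> 'd \<Rightarrow> int" where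
  "dyadic_label n x = (\<lambda>i. \<lfloor>2 ^ n * x $ i\<rfloor>)"

lemma dyadic_label_Suc: "(\<lambda>i. dyadic_label (Suc n) x i div 2) = dyadic_label n x"
proof
  fix i
  have "\<lfloor>2 ^ Suc n * x $ i\<rfloor> div 2 = \<lfloor>(2 ^ Suc n * x $ i) / real_of_int 2\<rfloor>"
    by (rule floor_divide_real_eq_div[symmetric]) simp
  then show "dyadic_label (Suc n) x i div 2 = dyadic_label n x i"
    by (simp add: dyadic_label_def)
qed

lemma norm_le_card_mult:
  fixes x :: "real^'d" and b :: real
  assumes "\<And>i. \<bar>x $ i\<bar> \<le> b"
  shows "norm x \<le> CARD('d) * b"
proof -
  have "norm x \<le> (\<Sum>i\<in>UNIV. \<bar>x $ i\<bar>)" by (rule norm_le_l1_cart)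
  also have "\<dots> \<le> CARD('d) * b" using sum_bounded_above[of UNIV "\<lambda>i. \<bar>x $ i\<bar>" b] assms by simp
  finally show ?thesis .
qed

lemma norm_diff_dyadic_label_eq:
  fixes x y :: "real^'d"
  assumes "dyadic_label n x = dyadic_label n y"
  shows "norm (x - y) \<le> CARD('d) / 2 ^ n"
proof -
  have "\<bar>(x - y) $ i\<bar> \<le> 1 / 2 ^ n" for i
  proof -
    have "\<lfloor>2 ^ n * x $ i\<rfloor> = \<lfloor>2 ^ n * y $ i\<rfloor>" using assms by (auto simp: dyadic_label_def fun_eq_iff)
    then have "\<bar>2 ^ n * x $ i - 2 ^ n * y $ i\<bar> \<le> 1" by linarith
    also have "2 ^ n * x $ i - 2 ^ n * y $ i = 2 ^ n * (x - y) $ i" by (simp add: algebra_simps)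
    finally have "2 ^ n * \<bar>(x - y) $ i\<bar> \<le> 1" by (simp only: abs_mult power_abs abs_numeral)
    then show ?thesis by (subst pos_le_divide_eq) (simp_all add: mult.commute)
  qed
  from norm_le_card_mult[of "x - y", OF this] show ?thesis by simp
qed

lemma finite_dyadic_labels:
  fixes E :: "(real^'d) set"
  assumes "bounded E"
  shows "finite (dyadic_label n ` E)"
proof -
  obtain b where b: "\<And>x. x \<in> E \<Longrightarrow> norm x \<le> b" using assms by (auto simp: bounded_iff)
  have "dyadic_label n ` E \<subseteq> (\<Pi>\<^sub>E i\<in>UNIV. {\<lfloor>- (2 ^ n * b)\<rfloor>..\<lfloor>2 ^ n * b\<rfloor>})"
  proof safe
    fix x i assume x: "x \<in> E"
    have "\<bar>x $ i\<bar> \<le> b" using component_le_norm_cart[of x i] b[OF x] by linarith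
    then have "- (2 ^ n * b) \<le> 2 ^ n * x $ i" "2 ^ n * x $ i \<le> 2 ^ n * b"
      using mult_left_mono[of "- b" "x $ i" "2 ^ n :: real"] mult_left_mono[of "x $ i" b "2 ^ n :: real"] by (auto simp: abs_le_iff)
    then show "dyadic_label n x i \<in> {\<lfloor>- (2 ^ n * b)\<rfloor>..\<lfloor>2 ^ n * b\<rfloor>}"
      by (auto simp: dyadic_label_def intro: floor_mono)
  qed auto
  then show ?thesis by (rule finite_subset) (auto intro: finite_PiE)
qed

text \<open>The cut at 1 gives a real-valued content on all sets, as \<open>mass_tree\<close>
  requires, and preserves positivity and subadditivity.\<close>

definition truncated_content :: "real \<Rightarrow> real \<Rightarrow> 'a::metric_space set \<Rightarrow> real" where
  "truncated_content s \<delta> A = enn2real (min 1 (hausdorff_content s \<delta> A))"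

lemma ennreal_truncated_content: "ennreal (truncated_content s \<delta> A) = min 1 (hausdorff_content s \<delta> A)"
  unfolding truncated_content_def by (rule ennreal_enn2real) (rule le_less_trans[OF min.cobounded1], simp)

lemma truncated_content_nonneg: "truncated_content s \<delta> A \<ge> 0"
  by (simp add: truncated_content_def)

text \<open>A set of diameter at most \<open>\<delta>\<close> covers itself. A larger one is not an
  admissible cover, but then the cut at 1 gives the bound, since
  \<open>diameter A / \<delta>\<close> exceeds 1; this is the second summand of the
  constant.\<close>

lemma truncated_content_le:
  assumes "s > 0" "\<delta> > 0" "bounded A"
  shows "truncated_content s \<delta> A \<le> (1 + (1 / \<delta>) powr s) * diameter A powr s"
proof (cases "diameter A \<le> \<delta>")
  case True
  have "ennreal (truncated_content s \<delta> A) \<le> ennreal (diameter A powr s)"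
    using hausdorff_content_le_diameter[of s \<delta> A] assms True unfolding ennreal_truncated_content by (auto intro: min.coboundedI2)
  then have "truncated_content s \<delta> A \<le> 1 * diameter A powr s" by simp
  also have "\<dots> \<le> (1 + (1 / \<delta>) powr s) * diameter A powr s" by (intro mult_right_mono) auto
  finally show ?thesis .
next
  case False
  have "ennreal (truncated_content s \<delta> A) \<le> ennreal 1"
    unfolding ennreal_truncated_content by simp
  then have "truncated_content s \<delta> A \<le> 1" by simp
  also have "1 \<le> (1 / \<delta> * diameter A) powr s" using False assms by (intro ge_one_powr_ge_zero) (auto simp: field_simps)
  also have "\<dots> = (1 / \<delta>) powr s * diameter A powr s" by (rule powr_mult)
  also have "\<dots> \<le> (1 + (1 / \<delta>) powr s) * diameter A powr s" by (intro mult_right_mono) auto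
  finally show ?thesis .
qed

lemma truncated_content_Un: "truncated_content s \<delta> (A \<union> B) \<le> truncated_content s \<delta> A + truncated_content s \<delta> B"
proof -
  have "ennreal (truncated_content s \<delta> (A \<union> B)) \<le> ennreal (truncated_content s \<delta> A) + ennreal (truncated_content s \<delta> B)"
  proof -
    have "min 1 (a + b) \<le> min 1 a + min 1 b" for a b :: ennreal
      by (auto simp: min_def intro: add_increasing add_increasing2)
    then show ?thesis unfolding ennreal_truncated_content
      using hausdorff_content_Un[of s \<delta> A B] by (meson min.mono order_refl order_trans)
  qed
  then show ?thesis by (simp add: truncated_content_nonneg flip: ennreal_plus)
qed

lemma truncated_content_empty: "s > 0 \<Longrightarrow> \<delta> > 0 \<Longrightarrow> truncated_content s \<delta> {} = 0"
  using truncated_content_le[of s \<delta> "{}"] truncated_content_nonneg[of s \<delta> "{}"] by (auto intro: antisym)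

lemma card_labels_near:
  fixes x :: "real^'d"
  shows "finite (\<Pi>\<^sub>E i\<in>(UNIV :: 'd set). {\<lfloor>2 ^ n * x $ i\<rfloor> - int m..\<lfloor>2 ^ n * x $ i\<rfloor> + int m})"
    and "card (\<Pi>\<^sub>E i\<in>(UNIV :: 'd set). {\<lfloor>2 ^ n * x $ i\<rfloor> - int m..\<lfloor>2 ^ n * x $ i\<rfloor> + int m}) = (2 * m + 1) ^ CARD('d)"
proof -
  have "card {a - int m..a + int m} = 2 * m + 1" for a
    unfolding card_atLeastAtMost_int by linarith
  then show "card (\<Pi>\<^sub>E i\<in>(UNIV :: 'd set). {\<lfloor>2 ^ n * x $ i\<rfloor> - int m..\<lfloor>2 ^ n * x $ i\<rfloor> + int m}) = (2 * m + 1) ^ CARD('d)"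
    by (simp add: card_PiE del: card_atLeastAtMost_int)
qed (auto intro: finite_PiE)

text \<open>One of the \<open>m\<close> units absorbs the rounding of the two floors.\<close>

lemma dyadic_label_near:
  fixes x y :: "real^'d"
  assumes "norm (x - y) \<le> (real m - 1) / 2 ^ n"
  shows "dyadic_label n y \<in> (\<Pi>\<^sub>E i\<in>UNIV. {\<lfloor>2 ^ n * x $ i\<rfloor> - int m..\<lfloor>2 ^ n * x $ i\<rfloor> + int m})"
proof -
  have "dyadic_label n y i \<in> {\<lfloor>2 ^ n * x $ i\<rfloor> - int m..\<lfloor>2 ^ n * x $ i\<rfloor> + int m}" for i
  proof -
    have "\<bar>(x - y) $ i\<bar> \<le> (real m - 1) / 2 ^ n" using component_le_norm_cart[of "x - y" i] assms by linarith
    then have "2 ^ n * \<bar>(x - y) $ i\<bar> \<le> real m - 1" by (subst (asm) pos_le_divide_eq) (simp_all add: mult.commute)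
    then have "\<bar>2 ^ n * (x - y) $ i\<bar> \<le> real m - 1" by (simp only: abs_mult power_abs abs_numeral)
    also have "2 ^ n * (x - y) $ i = 2 ^ n * x $ i - 2 ^ n * y $ i" by (simp add: algebra_simps)
    finally have "\<bar>2 ^ n * x $ i - 2 ^ n * y $ i\<bar> \<le> real m - 1" .
    then have "\<bar>2 ^ n * x $ i - 2 ^ n * y $ i\<bar> \<le> real_of_int (int m) - 1" by simp
    then show ?thesis unfolding dyadic_label_def by simp linarith
  qed
  then show ?thesis by auto
qed

lemma hausdorff_content_pos:
  assumes "hausdorff_measure s E \<noteq> 0"
  obtains \<delta> where "\<delta> > 0" "hausdorff_content s \<delta> E > 0"
proof -
  have "0 < (SUP \<delta> \<in> {0<..}. hausdorff_content s \<delta> E)"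
    using assms by (simp add: hausdorff_measure_def zero_less_iff_neq_zero)
  then show ?thesis using that by (auto simp: less_SUP_iff)
qed

lemma dyadic_scale:
  fixes r :: real assumes "0 < r" "r < 1"
  obtains n where "1 / 2 ^ Suc n \<le> r" "r \<le> 1 / 2 ^ n"
proof -
  have ex: "\<exists>n. 1 / 2 ^ Suc n \<le> r"
  proof -
    obtain n where "(1/2 :: real) ^ n < r" using real_arch_pow_inv[of r "1/2"] assms by auto
    moreover have "(1/2 :: real) ^ Suc n \<le> (1/2) ^ n" by simp
    ultimately have "1 / 2 ^ Suc n \<le> r" by (simp add: power_divide)
    then show ?thesis by blast
  qed
  define n where "n = (LEAST n. 1 / 2 ^ Suc n \<le> r)"
  have 1: "1 / 2 ^ Suc n \<le> r" unfolding n_def by (rule LeastI_ex[OF ex])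
  have 2: "r \<le> 1 / 2 ^ n"
  proof (cases n)
    case (Suc m)
    then have "\<not> 1 / 2 ^ Suc m \<le> r" using not_less_Least[of m "\<lambda>n. 1 / 2 ^ Suc n \<le> r"] by (simp add: n_def)
    then show ?thesis using Suc by simp
  qed (use assms in simp)
  show ?thesis using that 1 2 by blast
qed

text \<open>The measure is the law of the point to which a random branch of dyadic cubes shrinks. A
  ball meets boundedly many cubes of its own size, each reached with probability at most a constant
  times its diameter to the power \<open>s\<close>.\<close>

theorem frostman:
  fixes E :: "(real^'d) set"
  assumes E: "compact E" and s: "s > 0" and H: "hausdorff_measure s E \<noteq> 0"
  obtains M C R where "frostman_measure M C s R" "AE x in M. x \<in> E"
proof -
  obtain \<delta> where \<delta>: "\<delta> > 0" "hausdorff_content s \<delta> E > 0" using hausdorff_content_pos[OF H] .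
  let ?c = "truncated_content s \<delta> :: (real^'d) set \<Rightarrow> real"
  let ?D = "real CARD('d)"
  define K where "K = 1 + (1 / \<delta>) powr s"
  have K: "K > 0" by (simp add: K_def add_pos_nonneg)
  have bE: "bounded E" by (rule compact_imp_bounded[OF E])
  have "?c E > 0"
  proof -
    have "ennreal (?c E) > 0" unfolding ennreal_truncated_content using \<delta>(2) by simp
    then show ?thesis by (simp add: ennreal_less_zero_iff)
  qed
  moreover have "?c E \<le> (\<Sum>l\<in>dyadic_label 0 ` E. ?c {x \<in> E. dyadic_label 0 x = l})"
  proof -
    have "E = (\<Union>l\<in>dyadic_label 0 ` E. {x \<in> E. dyadic_label 0 x = l})" by auto
    then show ?thesis
      using subadditive_UN[of ?c "dyadic_label 0 ` E" "\<lambda>l. {x \<in> E. dyadic_label 0 x = l}"]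
        truncated_content_empty[OF s \<delta>(1)] truncated_content_Un finite_dyadic_labels[OF bE] by metis
  qed
  ultimately have "(\<Sum>l\<in>dyadic_label 0 ` E. ?c {x \<in> E. dyadic_label 0 x = l}) > 0" by linarith
  \<comment> \<open>Finitely many unit cubes meet the bounded set \<open>E\<close>, so subadditivity
    forces one of them to have positive content.\<close>
  then obtain root where root: "?c {x \<in> E. dyadic_label 0 x = root} > 0"
    using sum_nonpos[of "dyadic_label 0 ` E" "\<lambda>l. ?c {x \<in> E. dyadic_label 0 x = l}"] by (meson not_less)
  interpret T: mass_tree dyadic_label "\<lambda>l i. l i div 2" E ?c root
    using dyadic_label_Suc finite_dyadic_labels[OF bE] truncated_content_nonneg truncated_content_empty[OF s \<delta>(1)] truncated_content_Un root
    by unfold_locales auto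
  interpret P: prob_space T.choice_measure by (rule T.prob_space_choice_measure)
  define pt where "pt n l = (SOME x. x \<in> T.cell n l)" for n l
  define X where "X \<omega> = lim (\<lambda>n. pt n (T.branch \<omega> n))" for \<omega>
  have Xm[measurable]: "X \<in> borel_measurable T.choice_measure"
    unfolding X_def[abs_def]
  proof (rule borel_measurable_lim_metric)
    fix n
    show "(\<lambda>\<omega>. pt n (T.branch \<omega> n)) \<in> borel_measurable T.choice_measure"
      by (rule measurable_compose[OF T.measurable_branch]) simp
  qed
  \<comment> \<open>The cubes are half-open, so the limit may leave the cube of its own branch. Only
    closeness to some point \<open>y\<close> of each cube is recorded.\<close>
  have good: "AE \<omega> in T.choice_measure. X \<omega> \<in> E \<and>
      (\<forall>n. \<exists>y. dyadic_label n y = T.branch \<omega> n \<and> norm (X \<omega> - y) \<le> ?D / 2 ^ n)"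
    using T.AE_branch
  proof eventually_elim
    case (elim \<omega>)
    define x where "x n = pt n (T.branch \<omega> n)" for n
    have x: "x n \<in> E" "dyadic_label n (x n) = T.branch \<omega> n" for n
    proof -
      have "T.cell n (T.branch \<omega> n) \<noteq> {}" using elim truncated_content_empty[OF s \<delta>(1)] by (metis less_irrefl)
      then have "x n \<in> T.cell n (T.branch \<omega> n)" unfolding x_def pt_def by (simp add: some_in_eq)
      then show "x n \<in> E" "dyadic_label n (x n) = T.branch \<omega> n" by (auto simp: T.cell_def)
    qed
    have anc: "dyadic_label n (x (n + k)) = T.branch \<omega> n" for n k
    proof (induction k arbitrary: n)
      case (Suc k)
      have "dyadic_label n (x (n + Suc k)) = (\<lambda>i. dyadic_label (Suc n) (x (Suc n + k)) i div 2)"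
        by (simp add: dyadic_label_Suc)
      also have "\<dots> = (\<lambda>i. T.branch \<omega> (Suc n) i div 2)" unfolding Suc ..
      also have "\<dots> = T.branch \<omega> n" using elim by blast
      finally show ?case .
    qed (simp add: x)
    have near: "norm (x m - x n) \<le> ?D / 2 ^ n" if "n \<le> m" for m n
      using anc[of n "m - n"] that x(2)[of n] by (intro norm_diff_dyadic_label_eq) simp
    have lim0: "(\<lambda>n. ?D / 2 ^ n) \<longlonglongrightarrow> 0"
      using tendsto_mult[OF tendsto_const[of ?D] LIMSEQ_power_zero[of "1/2 :: real"]] by (simp add: power_divide)
    have "Cauchy x"
    proof (rule metric_CauchyI)
      fix e :: real assume e: "0 < e"
      obtain N where N: "?D / 2 ^ N < e / 2"
        using order_tendstoD(2)[OF lim0, of "e / 2"] e by (auto simp: eventually_sequentially)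
      have "dist (x m) (x n) < e" if "N \<le> m" "N \<le> n" for m n
      proof -
        have "dist (x m) (x n) \<le> dist (x m) (x N) + dist (x n) (x N)" by (rule dist_triangle2)
        also have "\<dots> < e" using near[OF that(1)] near[OF that(2)] N unfolding dist_norm by linarith
        finally show ?thesis .
      qed
      then show "\<exists>N. \<forall>m\<ge>N. \<forall>n\<ge>N. dist (x m) (x n) < e" by blast
    qed
    then have lim: "x \<longlonglongrightarrow> X \<omega>"
      unfolding X_def x_def[symmetric] by (simp add: Cauchy_convergent_iff convergent_LIMSEQ_iff)
    have "X \<omega> \<in> E" using closed_sequentially[OF compact_imp_closed[OF E] _ lim] x by auto
    moreover have "norm (X \<omega> - x n) \<le> ?D / 2 ^ n" for n
    proof (rule LIMSEQ_le_const2)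
      show "(\<lambda>m. norm (x m - x n)) \<longlonglongrightarrow> norm (X \<omega> - x n)" by (intro tendsto_intros lim)
      show "\<exists>N. \<forall>m\<ge>N. norm (x m - x n) \<le> ?D / 2 ^ n" using near by blast
    qed
    ultimately show ?case using x by blast
  qed
  define M where "M = distr T.choice_measure borel X"
  have prob: "prob_space M" unfolding M_def by (rule P.prob_space_distr) measurable
  have ME: "AE x in M. x \<in> E"
    unfolding M_def using good compact_imp_closed[OF E] by (subst AE_distr_iff) auto
  obtain R where R: "R \<ge> 0" "\<And>x. x \<in> E \<Longrightarrow> norm x \<le> R"
    using bE by (metis bounded_pos less_imp_le)
  define c0 where "c0 = ?c (T.cell 0 root)"
  have c0: "c0 > 0" using root by (simp add: c0_def T.cell_def)
  \<comment> \<open>A point of the cube lies within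
    \<open>r + CARD('d) / 2^n <= (m - 1) / 2^n\<close> of the centre of the ball, as
    \<open>dyadic_label_near\<close> requires.\<close>
  define m where "m = CARD('d) + 2"
  \<comment> \<open>Number of nearby cubes times the bound for one cube; the factor 2 comes from
    \<open>1 / 2^n <= 2 * r\<close>. The summand 1 handles \<open>r >= 1\<close>, where total mass 1
    suffices.\<close>
  define C where "C = 1 + real ((2 * m + 1) ^ CARD('d)) * (K * (2 * ?D) powr s / c0)"
  have C: "C \<ge> 1" using K c0 by (simp add: C_def)
  have ball: "emeasure M (cball x r) \<le> ennreal (C * r powr s)" if r: "r > 0" for x r
  proof (cases "r < 1")
    case False
    have "emeasure M (cball x r) \<le> 1" by (rule prob_space.emeasure_le_1[OF prob])
    also have "1 = ennreal (1 * 1)" by simp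
    also have "\<dots> \<le> ennreal (C * r powr s)"
      using C False s by (intro ennreal_leI mult_mono ge_one_powr_ge_zero) auto
    finally show ?thesis .
  next
    case True
    obtain n where n: "1 / 2 ^ Suc n \<le> r" "r \<le> 1 / 2 ^ n" using dyadic_scale[OF r True] .
    let ?Q = "\<Pi>\<^sub>E i\<in>(UNIV :: 'd set). {\<lfloor>2 ^ n * x $ i\<rfloor> - int m..\<lfloor>2 ^ n * x $ i\<rfloor> + int m}"
    have bs: "{\<omega>. T.branch \<omega> n = l} \<in> sets T.choice_measure" for l
      using measurable_sets[OF T.measurable_branch[of n], of "{l}"] by (simp add: T.space_choice_measure vimage_def)
    have cl: "?c (T.cell n l) \<le> K * (2 * ?D * r) powr s" for l
    proof -
      have "diameter (T.cell n l) \<le> ?D / 2 ^ n"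
        by (rule diameter_le) (auto simp: T.cell_def intro: norm_diff_dyadic_label_eq)
      also have "\<dots> \<le> 2 * ?D * r" using mult_left_mono[OF n(1), of "2 * ?D"] by simp
      finally have d: "diameter (T.cell n l) \<le> 2 * ?D * r" .
      have b: "bounded (T.cell n l)" using bE by (rule bounded_subset) (auto simp: T.cell_def)
      have "?c (T.cell n l) \<le> K * diameter (T.cell n l) powr s"
        unfolding K_def by (rule truncated_content_le[OF s \<delta>(1) b])
      also have "\<dots> \<le> K * (2 * ?D * r) powr s"
        using d s K diameter_ge_0[OF b] by (intro mult_left_mono powr_mono2) auto
      finally show ?thesis .
    qed
    have "emeasure M (cball x r) = emeasure T.choice_measure {\<omega>. X \<omega> \<in> cball x r}"
      unfolding M_def by (subst emeasure_distr) (auto simp: T.space_choice_measure vimage_def)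
    also have "\<dots> \<le> emeasure T.choice_measure (\<Union>l\<in>?Q. {\<omega>. T.branch \<omega> n = l})"
    proof (rule emeasure_mono_AE)
      show "AE \<omega> in T.choice_measure. \<omega> \<in> {\<omega>. X \<omega> \<in> cball x r} \<longrightarrow> \<omega> \<in> (\<Union>l\<in>?Q. {\<omega>. T.branch \<omega> n = l})"
        using good
      proof (eventually_elim, intro impI)
        fix \<omega>
        assume g: "X \<omega> \<in> E \<and> (\<forall>n. \<exists>y. dyadic_label n y = T.branch \<omega> n \<and> norm (X \<omega> - y) \<le> ?D / 2 ^ n)"
          and "\<omega> \<in> {\<omega>. X \<omega> \<in> cball x r}"
        then have X: "norm (x - X \<omega>) \<le> r" by (simp add: dist_norm)
        obtain y where y: "dyadic_label n y = T.branch \<omega> n" "norm (X \<omega> - y) \<le> ?D / 2 ^ n" using g by blast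
        have "norm (x - y) \<le> norm (x - X \<omega>) + norm (X \<omega> - y)" using norm_triangle_ineq[of "x - X \<omega>" "X \<omega> - y"] by simp
        also have "\<dots> \<le> 1 / 2 ^ n + ?D / 2 ^ n" using X y n by linarith
        also have "\<dots> = (real m - 1) / 2 ^ n" by (simp add: m_def add_divide_distrib)
        finally have "dyadic_label n y \<in> ?Q" by (rule dyadic_label_near)
        then show "\<omega> \<in> (\<Union>l\<in>?Q. {\<omega>. T.branch \<omega> n = l})" using y by auto
      qed
      show "(\<Union>l\<in>?Q. {\<omega>. T.branch \<omega> n = l}) \<in> sets T.choice_measure"
        using card_labels_near(1) bs by (intro sets.finite_UN) auto
    qed
    also have "\<dots> \<le> (\<Sum>l\<in>?Q. emeasure T.choice_measure {\<omega>. T.branch \<omega> n = l})"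
      using card_labels_near(1) bs by (intro emeasure_subadditive_finite) auto
    also have "\<dots> \<le> (\<Sum>l\<in>?Q. ennreal (K * (2 * ?D * r) powr s / c0))"
      using cl c0 unfolding c0_def
      by (intro sum_mono order_trans[OF T.emeasure_branch_le] ennreal_leI divide_right_mono) auto
    also have "\<dots> = ennreal (real ((2 * m + 1) ^ CARD('d)) * (K * (2 * ?D * r) powr s / c0))"
      unfolding sum_constant card_labels_near(2) ennreal_of_nat_eq_real_of_nat using K c0
      by (intro ennreal_mult[symmetric]) auto
    also have "\<dots> \<le> ennreal (C * r powr s)"
    proof (rule ennreal_leI)
      have "(2 * ?D * r) powr s = (2 * ?D) powr s * r powr s" using r by (simp add: powr_mult)
      then have "real ((2 * m + 1) ^ CARD('d)) * (K * (2 * ?D * r) powr s / c0)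
         = (C - 1) * r powr s" by (simp add: C_def)
      also have "\<dots> \<le> C * r powr s" by (intro mult_right_mono) auto
      finally show "real ((2 * m + 1) ^ CARD('d)) * (K * (2 * ?D * r) powr s / c0) \<le> C * r powr s" .
    qed
    finally show ?thesis .
  qed
  have "frostman_measure M C s R"
  proof (rule frostman_measure.intro)
    show "prob_space M" by (rule prob)
    show "AE x in M. norm x \<le> R" using ME by eventually_elim (rule R(2))
  qed (use s C R ball in \<open>auto simp: M_def\<close>)
  then show ?thesis using that ME by blast
qed

section \<open>Positive measure of the distance set\<close>

lemma hausdorff_measure_nonzero_below_dim:
  assumes "0 < s" "s < hausdorff_dim E"
  shows "hausdorff_measure s E \<noteq> 0"
proof
  assume "hausdorff_measure s E = 0"
  then have "hausdorff_dim E \<le> s"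
    unfolding hausdorff_dim_def using assms(1) by (intro cInf_lower) (auto intro: bdd_belowI[of _ 0])
  then show False using assms(2) by simp
qed

text \<open>Secures measurability: \<open>emeasure\<close> is 0 on non-measurable sets by
  convention, so vanishing alone would not make the distance set negligible.\<close>

lemma compact_G_distance_set:
  fixes ends :: "'e::finite \<Rightarrow> 'v::finite \<times> 'v" and E :: "(real^'d) set"
  assumes "compact E"
  shows "compact (G_distance_set ends E)"
proof -
  let ?K = "Pi\<^sub>E (UNIV :: 'v set) (\<lambda>_. E)"
  have "compactin (product_topology (\<lambda>_. euclidean) UNIV) ?K"
    using assms by (simp add: compactin_PiE)
  then have "compact ?K" by (simp add: euclidean_product_topology)
  moreover have "continuous_on ?K (\<lambda>x. \<chi> e. dist (x (fst (ends e))) (x (snd (ends e))))"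
    by (intro continuous_on_vec_lambda continuous_on_dist continuous_on_subset[OF continuous_on_product_coordinates] subset_UNIV)
  ultimately have "compact ((\<lambda>x. \<chi> e. dist (x (fst (ends e))) (x (snd (ends e)))) ` ?K)"
    by (intro compact_continuous_image)
  moreover have "G_distance_set ends E = (\<lambda>x. \<chi> e. dist (x (fst (ends e))) (x (snd (ends e)))) ` ?K"
    by (auto simp: G_distance_set_def PiE_UNIV_domain)
  ultimately show ?thesis by simp
qed

text \<open>Differentiable maps between spaces of equal dimension preserve negligible sets, which
  allows passing from distances to squared distances.\<close>

lemma differentiable_on_coordinate_square:
  "(\<lambda>v :: real^'e. \<chi> e. (v $ e)\<^sup>2) differentiable_on S"
  unfolding differentiable_on_def
proof (intro ballI, subst differentiable_componentwise_within, intro ballI)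
  fix v b :: "real^'e" assume "b \<in> Basis"
  then obtain e where b: "b = axis e 1" by (auto simp: Basis_vec_def)
  have "((\<lambda>v :: real^'e. (v $ e)\<^sup>2) has_derivative (\<lambda>h. 2 * h $ e * v $ e)) (at v within S)"
    by (auto intro!: derivative_eq_intros bounded_linear.has_derivative[OF bounded_linear_vec_nth])
  then show "(\<lambda>v. (\<chi> e. (v $ e)\<^sup>2) \<bullet> b) differentiable (at v within S)"
    unfolding b inner_axis by (auto simp: differentiable_def)
qed

theorem theorem1p2:
  fixes ends :: "'e::finite \<Rightarrow> 'v::{finite,linorder} \<times> 'v"
    and k :: nat
    and E :: "(real^'d) set"
  assumes "simple_graph ends"
    and "k_degenerate ends k"
    and "k < CARD('d)"
    and "compact E"
    and "hausdorff_dim E > (real CARD('d) + real k) / 2"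
  shows "emeasure lebesgue (G_distance_set ends E) > 0"
proof -
  obtain s where s: "(real CARD('d) + real k) / 2 < s" "s < hausdorff_dim E"
    using dense[OF assms(5)] by blast
  have s0: "s > 0" using s(1) by (rule le_less_trans[rotated]) simp
  have H: "hausdorff_measure s E \<noteq> 0" by (rule hausdorff_measure_nonzero_below_dim[OF s0 s(2)])
  obtain M C R where fm: "frostman_measure M C s R" and ME: "AE x in M. x \<in> E"
    using frostman[OF assms(4) s0 H] .
  interpret F: frostman_measure M C s R by (rule fm)
  interpret PP: prob_space "Pi\<^sub>M (UNIV :: 'v set) (\<lambda>_. M)" by (intro prob_space_PiM F.prob)
  interpret G: prob_space "gauss_measure :: (real^'e) measure" by (rule prob_space_gauss_measure)
  have comp: "compact (G_distance_set ends E)" by (rule compact_G_distance_set[OF assms(4)])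
  show ?thesis
  proof (rule ccontr)
    assume "\<not> ?thesis"
    then have "emeasure lebesgue (G_distance_set ends E) = 0" by simp
    then have neg: "negligible (G_distance_set ends E)"
      using lmeasurable_compact[OF comp] by (simp add: negligible_iff_null_sets null_sets_def fmeasurable_def)
    define sq :: "real^'e \<Rightarrow> real^'e" where "sq v = (\<chi> e. (v $ e)\<^sup>2)" for v
    define Z where "Z = sq ` G_distance_set ends E"
    have Zneg: "negligible Z"
      unfolding Z_def
      by (rule negligible_differentiable_image_negligible[OF _ neg])
        (simp_all add: sq_def[abs_def] differentiable_on_coordinate_square)
    have "compact Z" unfolding Z_def
      by (intro compact_continuous_image comp) (auto simp: sq_def[abs_def] intro!: continuous_intros)
    then have Zs: "Z \<in> sets borel" by (rule borel_compact)
    have Znull: "Z \<in> null_sets lborel"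
      using Zneg Zs by (simp add: negligible_iff_null_sets null_sets_def)
    \<comment> \<open>With all vertices present no filler coordinate remains, so the squared
      distance vector lies in \<open>Z\<close> with probability 1, while
      \<open>distance_map_null\<close> gives probability 0.\<close>
    have "AE x in Pi\<^sub>M (UNIV :: 'v set) (\<lambda>_. M). \<forall>v\<in>UNIV. x v \<in> E"
      by (intro AE_finite_allI AE_PiM_component F.prob ME) auto
    then have one: "AE x in Pi\<^sub>M (UNIV :: 'v set) (\<lambda>_. M).
        (\<integral>\<^sup>+t. indicator Z (distance_map ends UNIV x t) \<partial>gauss_measure) = 1"
    proof eventually_elim
      case (elim x)
      have "distance_map ends UNIV x t = sq (\<chi> e. dist (x (fst (ends e))) (x (snd (ends e))))" for t
        by (simp add: distance_map_def sq_def)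
      then have "distance_map ends UNIV x t \<in> Z" for t
        using elim unfolding Z_def G_distance_set_def by blast
      then show ?case using G.emeasure_space_1 by simp
    qed
    have "(\<integral>\<^sup>+x. \<integral>\<^sup>+t. indicator Z (distance_map ends UNIV x t) \<partial>gauss_measure \<partial>Pi\<^sub>M (UNIV :: 'v set) (\<lambda>_. M)) = (\<integral>\<^sup>+x. 1 \<partial>Pi\<^sub>M (UNIV :: 'v set) (\<lambda>_. M))"
      by (rule nn_integral_cong_AE[OF one])
    also have "\<dots> = 1" by (simp add: PP.emeasure_space_1)
    finally show False
      using F.distance_map_null[OF assms(1) _ _ Znull, of k UNIV] assms(2) s(1)
      by (simp add: k_degenerate_def field_simps)
  qed
qed

end
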